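(* Let $m\ge 3$ be odd, and let $C$ be a binary linear uniformly packed code with the same parameters (length $2^m-1$, dimension and minimum distance) as the BCH code $C_{1,3}$ of length $2^m-1$. Then the dual code $C^{\perp}$ is an $i$-component for every coordinate position $i$; that is, the graph $G_i(C^{\perp})$ is connected for every $i$.
   Context: $C_{1,3}$ is the binary primitive cyclic BCH code (designed distance 5) of length $2^m-1$ with zeros $\alpha$ and $\alpha^3$, where $\alpha$ is a primitive element of the Galois field $GF(2^m)$. Uniformly packed code (in the sense of Bassalygo, Zaitsev and Zinoviev): a binary code $C$ of length $N$ with covering radius $\rho$ is uniformly packed if there are real numbers $\alpha_0,\ldots,\alpha_\rho$ such that $\sum_{k=0}^{\rho}\alpha_k f_k(x)=1$ for every $x\in GF(2)^N$, where $f_k(x)$ is the number of codewords of $C$ at Hamming distance $k$ from $x$. $i$-component: for a binary code $D$ with minimum distance $\delta$ (the smallest Hamming distance between two different codewords) and a coordinate position $i$, let $G_i(D)$ be the graph whose vertices are the codewords of $D$ and whose edges are the pairs $(x,y)$ of codewords at Hamming distance $d(x,y)=\delta$ with $x_i\ne y_i$. A connected component of $G_i(D)$ is called an $i$-component of $D$. *)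

theory Defs
  imports
    "HOL-Analysis.Analysis"
    "HOL-Computational_Algebra.Polynomial"
    "HOL-Library.Z2"
    "Graph_Theory.Digraph_Component"
begin

text \<open>
  Binary words of length \<open>N\<close> are vectors \<open>bit ^ 'n\<close> with \<open>CARD('n) = N\<close>; linear codes and their
  dimension are the subspaces (\<open>vec.subspace\<close>) and dimension (\<open>vec.dim\<close>) over the field \<open>bit\<close>.
\<close>

type_synonym 'n code = "(bit ^ 'n) set"

definition hamming_dist :: "bit ^ 'n::finite \<Rightarrow> bit ^ 'n \<Rightarrow> nat" where
  "hamming_dist x y = card {i. x $ i \<noteq> y $ i}"

text \<open>Only meaningful for codes with at least two codewords.\<close>
definition min_dist :: "'n::finite code \<Rightarrow> nat" where
  "min_dist C = Min {hamming_dist x y | x y. x \<in> C \<and> y \<in> C \<and> x \<noteq> y}"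

definition covering_radius :: "'n::finite code \<Rightarrow> nat" where
  "covering_radius C = Max (range (\<lambda>x. Min (hamming_dist x ` C)))"

definition dual_code :: "'n::finite code \<Rightarrow> 'n code" where
  "dual_code C = {y. \<forall>x\<in>C. (\<Sum>i\<in>UNIV. x $ i * y $ i) = 0}"

definition codewords_at :: "'n::finite code \<Rightarrow> nat \<Rightarrow> bit ^ 'n \<Rightarrow> nat" where
  "codewords_at C k x = card {c \<in> C. hamming_dist x c = k}"

text \<open>Uniformly packed in the sense of Bassalygo, Zaitsev and Zinoviev.\<close>
definition uniformly_packed :: "'n::finite code \<Rightarrow> bool" where
  "uniformly_packed C \<longleftrightarrow>
     (\<exists>a :: nat \<Rightarrow> real. \<forall>x. (\<Sum>k = 0..covering_radius C. a k * real (codewords_at C k x)) = 1)"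

definition primitive_element :: "'f::{field,finite} \<Rightarrow> bool" where
  "primitive_element \<alpha> \<longleftrightarrow> range (\<lambda>k::nat. \<alpha> ^ k) = UNIV - {0}"

text \<open>
  The cyclic code with zeros \<open>\<alpha>\<close> and \<open>\<alpha>\<^sup>3\<close>. The index type carries no order, so a
  numbering \<open>pos\<close> of the coordinates by \<open>0, \<dots>, N - 1\<close> says which power of the
  indeterminate belongs to which coordinate.
\<close>
definition codeword_poly :: "('n::finite \<Rightarrow> nat) \<Rightarrow> bit ^ 'n \<Rightarrow> 'f::field poly" where
  "codeword_poly pos c = (\<Sum>i | c $ i = 1. monom 1 (pos i))"

definition bch_1_3 :: "('n::finite \<Rightarrow> nat) \<Rightarrow> 'f::field \<Rightarrow> 'n code" where
  "bch_1_3 pos \<alpha> =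
     {c. poly (codeword_poly pos c) \<alpha> = 0 \<and> poly (codeword_poly pos c) (\<alpha> ^ 3) = 0}"

text \<open>
  The undirected graph \<open>G\<^sub>i(D)\<close>, as a symmetric digraph: each edge occurs as both of its
  ordered pairs.
\<close>
definition i_graph :: "'n::finite \<Rightarrow> 'n code \<Rightarrow> (bit ^ 'n) pair_pre_digraph" where
  "i_graph i D =
     \<lparr> pverts = D,
       parcs = {(x, y). x \<in> D \<and> y \<in> D \<and> hamming_dist x y = min_dist D \<and> x $ i \<noteq> y $ i} \<rparr>"

text \<open>
  Because the digraph is symmetric, its strongly connected components are the connected
  components of the undirected graph; a component is identified with its set of codewords.
\<close>
definition i_component :: "'n::finite \<Rightarrow> 'n code \<Rightarrow> 'n code \<Rightarrow> bool" where
  "i_component i D S \<longleftrightarrow> S \<in> pre_digraph.sccs_verts (with_proj (i_graph i D))"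

end

theory Submission
  imports Defs
begin

text \<open>
  Write \<open>q = 2\<^sup>m\<close> and \<open>D\<close> for the dual code, and put \<open>Y u = q - 2 wt u\<close> for \<open>u \<in> D\<close>. The
  \<open>i\<close>-graph of \<open>D\<close> is connected iff the words of minimum weight containing \<open>i\<close> span \<open>D\<close>. If
  they do not, there is a word \<open>v\<close> outside \<open>C\<close> orthogonal to all of them, and summing
  \<open>(1 - \<chi>(u, e\<^sub>i)) (1 - \<chi>(u, v)) R(Y u)\<close> over \<open>D\<close>, where \<open>R\<close> is the polynomial vanishing at
  all values of \<open>Y\<close> on \<open>D - {0}\<close> except the largest, gives \<open>0\<close>. By Fourier inversion this is a relation
  between numbers of codewords of \<open>C\<close> at distance at most \<open>3\<close> from the four words
  \<open>0, e\<^sub>i, v, v + e\<^sub>i\<close>, and a comparison of sizes refutes it.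

  Uniform packing bounds the number of values of \<open>Y\<close> on \<open>D - {0}\<close> by the covering radius, which
  is at most \<open>4\<close> by a Johnson-type bound. Since \<open>C\<close> has minimum distance at least \<open>5\<close>, the first
  four power moments of \<open>Y\<close> are known. With at most three values they force \<open>Y u \<in> {0, \<plusminus> \<surd>(2 q)}\<close>.
  With four values, a word at distance \<open>4\<close> from \<open>C\<close> makes the product of the \<open>q - y\<close> over the values
  \<open>y\<close> divisible by \<open>8 q\<^sup>2\<close>; this divisibility together with the positivity of the
  multiplicities gives the required inequalities.
\<close>

section \<open>Powers of two\<close>

lemma pow2_decomp:
  fixes n :: int
  assumes "n \<noteq> 0"
  obtains e k where "n = 2 ^ e * k" "odd k"
proof -
  have "\<exists>e k. n = 2 ^ e * k \<and> odd k" using assms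
  proof (induction "nat \<bar>n\<bar>" arbitrary: n rule: less_induct)
    case less
    show ?case
    proof (cases "odd n")
      case True
      then show ?thesis by (intro exI[of _ 0] exI[of _ n]) simp
    next
      case False
      then have "even n" by simp
      then obtain l where l: "n = 2 * l" by (elim evenE)
      with less.prems have "nat \<bar>l\<bar> < nat \<bar>n\<bar>" "l \<noteq> 0" by auto
      from less.hyps[OF this] obtain e k where "l = 2 ^ e * k" "odd k" by blast
      with l show ?thesis by (intro exI[of _ "Suc e"] exI[of _ k]) simp
    qed
  qed
  with that show ?thesis by blast
qed

lemma pow2_dvd_mult_odd:
  fixes y g :: int
  assumes "2 ^ k dvd y * g" "odd g"
  shows "2 ^ k dvd y"
  using assms by (simp add: coprime_dvd_mult_left_iff)

lemma pow2_exponent_less: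
  fixes k :: int
  assumes "n = 2 ^ e * k" "n \<noteq> 0" "\<bar>n\<bar> < 2 ^ m"
  shows "e < m"
proof -
  have "k \<noteq> 0" using assms by auto
  then have "2 ^ e * 1 \<le> 2 ^ e * \<bar>k\<bar>" by (intro mult_left_mono) auto
  also have "\<dots> = \<bar>n\<bar>" using assms(1) by (simp add: abs_mult)
  finally have "(2::int) ^ e < 2 ^ m" using assms(3) by linarith
  then show ?thesis by simp
qed

text \<open>Excludes the degenerate case \<open>y1 y2 y3 = - q (y1 + y2 + y3)\<close> below, with
  \<open>b = - y1 y2\<close>, \<open>d = - y1 - y2\<close>, \<open>y = y3\<close>, \<open>z = y4\<close>.\<close>
lemma two_adic_obstruction:
  fixes b c d y z q :: int
  assumes q: "q = 2 ^ m" and b: "b > 0" and c: "c = q - b" "c > 0" and d: "d > 0"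
    and y: "0 < y" "y < q" "y * c = q * d" and z: "0 < z" "z < q"
    and eq: "(q - z) * (c * (q + c) + b * d - q * d\<^sup>2) = 2 * q * d * b"
  shows False
proof -
  obtain x b' where b': "b = 2 ^ x * b'" "odd b'" using b pow2_decomp[of b] by (metis less_irrefl)
  obtain e d' where d': "d = 2 ^ e * d'" "odd d'" using d pow2_decomp[of d] by (metis less_irrefl)
  obtain f g where g: "q - z = 2 ^ f * g" "odd g" using z pow2_decomp[of "q - z"] by (metis diff_gt_0_iff_gt less_irrefl)
  have xm: "x < m" using pow2_exponent_less[OF b'(1), of m] b c q by auto
  have fm: "f < m" using pow2_exponent_less[OF g(1), of m] z q by auto
  define c' where "c' = 2 ^ (m - x) - b'"
  have c': "c = 2 ^ x * c'" using c(1) xm unfolding c'_def q b'(1)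
    by (simp add: algebra_simps flip: power_add)
  have oc': "odd c'" using xm b'(2) by (simp add: c'_def)
  \<comment> \<open>Otherwise \<open>2 ^ x\<close> cancels from \<open>y * c = q * d\<close>, and
    \<open>y\<close> times the odd \<open>c'\<close> is a multiple of \<open>q\<close>, which is
    impossible for \<open>0 < y < q\<close>.\<close>
  have ex: "e < x"
  proof (rule ccontr)
    assume "\<not> e < x"
    then have "x \<le> e" by simp
    have "2 ^ x * (y * c') = 2 ^ x * (2 ^ m * (2 ^ (e - x) * d'))"
      using y(3) \<open>x \<le> e\<close> unfolding c' q d'(1) by (simp add: algebra_simps flip: power_add)
    then have "y * c' = 2 ^ m * (2 ^ (e - x) * d')" by simp
    then have "2 ^ m dvd y * c'" by simp
    then have "2 ^ m dvd y" using oc' by (rule pow2_dvd_mult_odd)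
    then show False using y q by (auto dest: zdvd_imp_le)
  qed
  \<comment> \<open>By \<open>e < x < m\<close>, two of the three summands of \<open>D'\<close> are
    even while \<open>b' * d'\<close> is odd, so \<open>2 ^ (e + x)\<close> is the exact power of
    two in \<open>D\<close>. By \<open>eq\<close> and \<open>f < m\<close> that power would be
    larger.\<close>
  define D where "D = c * (q + c) + b * d - q * d\<^sup>2"
  define D' where "D' = 2 ^ (x - e) * (c' * (2 ^ (m - x) + c')) + b' * d' - 2 ^ (m + e - x) * d'\<^sup>2"
  have "D = 2 ^ (e + x) * D'"
  proof -
    have 1: "c * (q + c) = 2 ^ (e + x) * (2 ^ (x - e) * (c' * (2 ^ (m - x) + c')))"
    proof -
      have "q = 2 ^ x * 2 ^ (m - x)" using xm q by (simp flip: power_add)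
      moreover have "(2::int) ^ (e + x) * 2 ^ (x - e) = 2 ^ x * 2 ^ x" using ex by (simp flip: power_add)
      ultimately show ?thesis unfolding c' by (metis (no_types, lifting) distrib_left mult.assoc mult.left_commute)
    qed
    have 2: "b * d = 2 ^ (e + x) * (b' * d')" unfolding b'(1) d'(1) by (simp add: power_add algebra_simps)
    have "(2::int) ^ (e + x) * 2 ^ (m + e - x) = 2 ^ m * (2 ^ e) ^ 2"
      using xm by (simp flip: power_add power_mult)
    then have 3: "q * d\<^sup>2 = 2 ^ (e + x) * (2 ^ (m + e - x) * d'\<^sup>2)"
      unfolding q d'(1) by (simp add: power_mult_distrib flip: mult.assoc)
    show ?thesis unfolding D_def D'_def 1 2 3 by (simp add: algebra_simps)
  qed
  moreover have "odd D'" using ex xm b'(2) d'(2) by (simp add: D'_def)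
  moreover have "2 ^ (e + x + 1) dvd D"
  proof -
    have "2 ^ f * (D * g) = 2 ^ f * (2 ^ (1 + m + e + x - f) * (d' * b'))"
    proof -
      have "2 ^ f * (D * g) = 2 * q * d * b" using eq unfolding g(1) D_def[symmetric] by (simp add: algebra_simps)
      also have "\<dots> = 2 ^ (1 + m + e + x) * (d' * b')" unfolding q d'(1) b'(1) by (simp add: power_add algebra_simps)
      also have "(2::int) ^ (1 + m + e + x) = 2 ^ f * 2 ^ (1 + m + e + x - f)" using fm by (simp flip: power_add)
      finally show ?thesis by (simp add: mult.assoc)
    qed
    then have "D * g = 2 ^ (1 + m + e + x - f) * (d' * b')" by simp
    then have "2 ^ (1 + m + e + x - f) dvd D * g" by simp
    then have "2 ^ (1 + m + e + x - f) dvd D" using g(2) by (rule pow2_dvd_mult_odd)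
    moreover have "(2::int) ^ (e + x + 1) dvd 2 ^ (1 + m + e + x - f)" using fm by (intro le_imp_power_dvd) simp
    ultimately show ?thesis by (rule dvd_trans[rotated])
  qed
  ultimately show False by simp
qed

lemma pow2_dvd_exponent_le:
  fixes k :: int
  assumes "2 ^ n dvd 2 ^ a * k" "odd k"
  shows "n \<le> a"
proof -
  have "(2::int) ^ n dvd 2 ^ a" using assms by (rule pow2_dvd_mult_odd)
  then have "(2::int) ^ n \<le> 2 ^ a" by (rule zdvd_imp_le) simp
  then show ?thesis by simp
qed

text \<open>Below \<open>2 ^ m\<close> in absolute value, \<open>y\<close> and
  \<open>2 ^ m - y\<close> have the same 2-adic valuation; this transfers divisibility from
  \<open>q - y\<close> to \<open>y\<close>.\<close>

lemma pow2_minus_decomp: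
  fixes y :: int
  assumes "y \<noteq> 0" "\<bar>y\<bar> < 2 ^ m"
  obtains e k l where "y = 2 ^ e * k" "2 ^ m - y = 2 ^ e * l" "odd k" "odd l" "e < m"
proof -
  obtain e k where k: "y = 2 ^ e * k" "odd k" using pow2_decomp[OF assms(1)] by blast
  have "e < m" using pow2_exponent_less[OF k(1) assms] .
  moreover from this have "2 ^ m - y = 2 ^ e * (2 ^ (m - e) - k)"
    by (simp add: k(1) algebra_simps flip: power_add)
  moreover have "odd ((2::int) ^ (m - e) - k)" using \<open>e < m\<close> k(2) by simp
  ultimately show ?thesis using that k by blast
qed

text \<open>Each factor has 2-adic valuation at most \<open>m\<close>.\<close>

lemma pow2_prod_bound:
  fixes a b :: int
  assumes "0 < a" "a < 2 ^ (m + 1)" "0 < b" "b < 2 ^ (m + 1)"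
  shows "\<not> 2 ^ (2 * m + 1) dvd a * b"
proof
  assume *: "2 ^ (2 * m + 1) dvd a * b"
  obtain e k where k: "a = 2 ^ e * k" "odd k" using pow2_decomp[of a] assms by (metis less_irrefl)
  obtain f l where l: "b = 2 ^ f * l" "odd l" using pow2_decomp[of b] assms by (metis less_irrefl)
  have "e < m + 1" "f < m + 1" using pow2_exponent_less[OF k(1), of "m + 1"] pow2_exponent_less[OF l(1), of "m + 1"] assms by auto
  moreover have "2 ^ (2 * m + 1) dvd 2 ^ (e + f) * (k * l)"
    using * by (simp add: k(1) l(1) power_add mult_ac)
  then have "2 * m + 1 \<le> e + f" by (rule pow2_dvd_exponent_le) (use k l in simp)
  ultimately show False by simp
qed

section \<open>Few values with prescribed moments\<close>

text \<open>\<open>E0\<close> and \<open>E1\<close> say that \<open>p(Y)\<close> and \<open>Y p(Y)\<close> sum to \<open>0\<close> over \<open>D - {0}\<close>, where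
  \<open>p = (y - y1) (y - y2) (y - y3)\<close>.\<close>
lemma three_values_rigid:
  fixes y1 y2 y3 q :: int
  assumes q: "q = 2 ^ m" and m: "m \<ge> 3"
    and ev: "even y1" "even y2" "even y3"
    and bounds: "\<bar>y1\<bar> \<le> q - 2" "\<bar>y2\<bar> \<le> q - 2" "\<bar>y3\<bar> \<le> q - 2"
    and e: "e1 = y1 + y2 + y3" "e2 = y1 * y2 + y1 * y3 + y2 * y3" "e3 = y1 * y2 * y3"
    and E0: "2 * q\<^sup>2 - e1 * q\<^sup>2 + e2 * q - e3 * (q + 1) = 0"
    and E1: "2 * q^3 - 2 * e1 * q\<^sup>2 + e2 * q\<^sup>2 - e3 * q = 0"
  shows "e1 = 0 \<and> e2 = - 2 * q \<and> e3 = 0"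
proof -
  have "(2::int) ^ 3 \<le> 2 ^ m" using m by (intro power_increasing) auto
  then have q8: "q \<ge> 8" using q by simp
  have "(2::int) ^ 3 dvd 2 ^ m" using m by (rule le_imp_power_dvd)
  then obtain r where r: "q = 8 * r" using q by (auto elim: dvdE)
  have "q * (2 * q\<^sup>2 - 2 * e1 * q + e2 * q - e3) = 0"
    using E1 by (simp add: algebra_simps power2_eq_square power3_eq_cube)
  then have e3: "e3 = 2 * q\<^sup>2 - 2 * e1 * q + e2 * q" using q8 by simp
  have "q * (e1 * q - 2 * q\<^sup>2 - e2 * q + 2 * e1) = 0"
    using E0 unfolding e3 by (simp add: algebra_simps power2_eq_square power3_eq_cube)
  then have "e1 * q - 2 * q\<^sup>2 - e2 * q + 2 * e1 = 0" using q8 by simp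
  then have e1: "2 * e1 = q * (e2 + 2 * q - e1)" by (simp add: algebra_simps power2_eq_square)
  \<comment> \<open>Now \<open>2 * e1 = q * k\<close>, and \<open>4\<close> divides \<open>k\<close>
    because the values are even, so \<open>e1 = 2 * q * l\<close>. For nonzero \<open>l\<close> the
    sum of squares \<open>e1^2 - 2 * e2\<close> exceeds its bound
    \<open>3 * (q - 2)^2\<close>.\<close>
  define k where "k = e2 + 2 * q - e1"
  have k: "e1 = 4 * r * k" using e1 unfolding k_def[symmetric] by (simp add: r)
  have e2: "e2 = e1 - 2 * q + k" by (simp add: k_def)
  obtain z1 z2 z3 where z: "y1 = 2 * z1" "y2 = 2 * z2" "y3 = 2 * z3" using ev by (elim evenE)
  have "e2 = 4 * (z1 * z2 + z1 * z3 + z2 * z3)" unfolding e z by (simp add: algebra_simps)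
  then have "4 dvd e2" by simp
  moreover have "k = e2 - 4 * (r * k - 4 * r)" using e2 unfolding k r by (simp add: algebra_simps)
  ultimately have "4 dvd k" by (metis dvd_diff dvd_triv_left)
  then obtain l where l: "k = 4 * l" by (elim dvdE)
  have e1l: "e1 = 2 * q * l" using k l r by simp
  have sq: "y1\<^sup>2 + y2\<^sup>2 + y3\<^sup>2 = e1\<^sup>2 - 2 * e2" unfolding e by (simp add: algebra_simps power2_eq_square)
  have "y\<^sup>2 \<le> (q - 2)\<^sup>2" if "\<bar>y\<bar> \<le> q - 2" for y using that q8 by (intro abs_le_square_iff[THEN iffD1]) simp
  then have "e1\<^sup>2 - 2 * e2 \<le> 3 * (q - 2)\<^sup>2" using bounds sq by (smt (verit))
  then have ineq: "4 * q\<^sup>2 * l\<^sup>2 - 4 * q * l - 8 * l + 4 * q \<le> 3 * (q - 2)\<^sup>2"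
    unfolding e2 l e1l by (simp add: algebra_simps power2_eq_square)
  have "l = 0"
  proof (rule ccontr)
    assume "l \<noteq> 0"
    have l2: "l \<le> l\<^sup>2" "1 \<le> l\<^sup>2"
    proof -
      show "1 \<le> l\<^sup>2" using \<open>l \<noteq> 0\<close> zero_less_power2[of l] by linarith
      show "l \<le> l\<^sup>2"
      proof (cases "l \<le> 0")
        case False
        then have "l * 1 \<le> l * l" by (intro mult_left_mono) auto
        then show ?thesis by (simp add: power2_eq_square)
      qed (use zero_le_power2[of l] in linarith)
    qed
    have "(4 * q + 8) * l \<le> (4 * q + 8) * l\<^sup>2" using l2 q8 by (intro mult_left_mono) auto
    moreover have "(4 * q\<^sup>2 - 4 * q - 8) * 1 \<le> (4 * q\<^sup>2 - 4 * q - 8) * l\<^sup>2"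
    proof (intro mult_left_mono)
      have "q * 8 \<le> q * q" using q8 by (intro mult_left_mono) auto
      then show "0 \<le> 4 * q\<^sup>2 - 4 * q - 8" unfolding power2_eq_square using q8 by linarith
    qed (use l2 in auto)
    ultimately have "4 * q\<^sup>2 - 8 \<le> 3 * (q - 2)\<^sup>2" using ineq by (simp add: algebra_simps)
    moreover have "q * 8 \<le> q * q" using q8 by (intro mult_left_mono) auto
    moreover have "(q - 2)\<^sup>2 = q * q - 4 * q + 4" by (simp add: algebra_simps power2_eq_square)
    ultimately show False unfolding power2_eq_square using q8 by linarith
  qed
  then have "e1 = 0" "k = 0" using e1l l by simp_all
  then show ?thesis using e2 e3 by (simp add: power2_eq_square)
qed

text \<open>\<open>ni\<close> is the number of nonzero dual words with \<open>Y u = yi\<close>, and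
  \<open>M0\<close> to \<open>M4\<close> are the power moments of \<open>Y\<close> on these words;
  \<open>dvd4\<close> and \<open>dvd_prod\<close> come from a word at distance \<open>4\<close> from
  the code. \<open>m \<ge> 4\<close> holds because four multiples of \<open>4\<close> do not fit
  strictly between \<open>-8\<close> and \<open>8\<close>.\<close>

locale four_values =
  fixes q n1 n2 n3 n4 y1 y2 y3 y4 :: int and m :: nat
  assumes q: "q = 2 ^ m" and m: "m \<ge> 4"
    and n_pos: "n1 > 0" "n2 > 0" "n3 > 0" "n4 > 0"
    and order: "y1 < y2" "y2 < y3" "y3 < y4"
    and bounds: "-q < y1" "y4 < q"
    and dvd4: "4 dvd y1" "4 dvd y2" "4 dvd y3" "4 dvd y4"
    and dvd_prod: "4 * q dvd y1 * y2 * y3"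
    and M0: "n1 + n2 + n3 + n4 = (q - 1) * (q + 1)"
    and M1: "n1 * y1 + n2 * y2 + n3 * y3 + n4 * y4 = (q - 1) * q"
    and M2: "n1 * y1\<^sup>2 + n2 * y2\<^sup>2 + n3 * y3\<^sup>2 + n4 * y4\<^sup>2 = (q - 1) * q\<^sup>2"
    and M3: "n1 * y1^3 + n2 * y2^3 + n3 * y3^3 + n4 * y4^3 = 2 * (q - 1) * q\<^sup>2"
    and M4: "n1 * y1^4 + n2 * y2^4 + n3 * y3^4 + n4 * y4^4 = 2 * (q - 1) * q^3"
begin

section \<open>Moment identities and inequalities for four values\<close>

definition moment :: "(int \<Rightarrow> int) \<Rightarrow> int" where
  "moment f = n1 * f y1 + n2 * f y2 + n3 * f y3 + n4 * f y4"

lemma q_ge: "q \<ge> 16" and dvd16_q: "16 dvd q"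
proof -
  have "(2::int) ^ 4 \<le> 2 ^ m" using m by (intro power_increasing) auto
  then show "q \<ge> 16" using q by simp
  have "(2::int) ^ 4 dvd 2 ^ m" using m by (rule le_imp_power_dvd)
  then show "16 dvd q" using q by simp
qed

lemma moment_quartic:
  assumes "\<And>y. f y = c0 + c1 * y + c2 * y\<^sup>2 + c3 * y^3 + c4 * y^4"
  shows "moment f = (q - 1) * (c0 * (q + 1) + c1 * q + c2 * q\<^sup>2 + 2 * c3 * q\<^sup>2 + 2 * c4 * q^3)"
proof -
  have "moment f = c0 * (n1 + n2 + n3 + n4) + c1 * (n1 * y1 + n2 * y2 + n3 * y3 + n4 * y4)
      + c2 * (n1 * y1\<^sup>2 + n2 * y2\<^sup>2 + n3 * y3\<^sup>2 + n4 * y4\<^sup>2)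
      + c3 * (n1 * y1^3 + n2 * y2^3 + n3 * y3^3 + n4 * y4^3)
      + c4 * (n1 * y1^4 + n2 * y2^4 + n3 * y3^4 + n4 * y4^4)"
    unfolding moment_def assms by (simp add: algebra_simps)
  then show ?thesis unfolding M0 M1 M2 M3 M4 by (simp add: algebra_simps)
qed

lemma moment_mean: "moment (\<lambda>y. (q - y) * y) = 0"
proof -
  have "moment (\<lambda>y. (q - y) * y) = (q - 1) * (0 * (q + 1) + q * q + (-1) * q\<^sup>2 + 2 * 0 * q\<^sup>2 + 2 * 0 * q^3)"
    by (rule moment_quartic) (simp add: algebra_simps power2_eq_square)
  then show ?thesis by (simp add: power2_eq_square)
qed

text \<open>The weight \<open>q - y\<close> is positive at all four values and vanishes at
  \<open>q\<close>, the value of \<open>Y\<close> at the zero word. Knowing the sign of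
  \<open>(y - s) * (y - t)\<close> at the four values thus yields a bound on
  \<open>s * t\<close>.\<close>

lemma moment_quad: "moment (\<lambda>y. (q - y) * ((y - s) * (y - t))) = (q - 1) * q\<^sup>2 * (q - 2 + s * t)"
proof -
  have "moment (\<lambda>y. (q - y) * ((y - s) * (y - t))) = (q - 1) * ((q * s * t) * (q + 1) + (- q * (s + t) - s * t) * q
      + (q + s + t) * q\<^sup>2 + 2 * (-1) * q\<^sup>2 + 2 * 0 * q^3)"
    by (rule moment_quartic) (simp add: algebra_simps power2_eq_square power3_eq_cube)
  then show ?thesis by (simp add: algebra_simps power2_eq_square power3_eq_cube)
qed

lemma moment_cubic: "moment (\<lambda>y. (q - y) * ((y - r) * (y - s) * (y - t)))
    = (q - 1) * q\<^sup>2 * (- ((r + s + t) * (q - 2) + r * s * t))"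
proof -
  have "moment (\<lambda>y. (q - y) * ((y - r) * (y - s) * (y - t))) =
      (q - 1) * ((- q * r * s * t) * (q + 1) + (q * (r * s + r * t + s * t) + r * s * t) * q
      + (- q * (r + s + t) - (r * s + r * t + s * t)) * q\<^sup>2 + 2 * (q + r + s + t) * q\<^sup>2 + 2 * (-1) * q^3)"
    by (rule moment_quartic) (simp add: algebra_simps power2_eq_square power3_eq_cube power4_eq_xxxx)
  then show ?thesis by (simp add: algebra_simps power2_eq_square power3_eq_cube)
qed

lemma moment_m0: "moment (\<lambda>y. (y - s) * (y - t)) = (q - 1) * (q\<^sup>2 - (s + t) * q + s * t * (q + 1))"
proof -
  have "moment (\<lambda>y. (y - s) * (y - t)) = (q - 1) * ((s * t) * (q + 1) + (- (s + t)) * q + 1 * q\<^sup>2 + 2 * 0 * q\<^sup>2 + 2 * 0 * q^3)"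
    by (rule moment_quartic) (simp add: algebra_simps power2_eq_square power3_eq_cube)
  then show ?thesis by (simp add: algebra_simps power2_eq_square power3_eq_cube)
qed

lemma moment_m1: "moment (\<lambda>y. y * ((y - s) * (y - t))) = (q - 1) * (2 * q\<^sup>2 - (s + t) * q\<^sup>2 + s * t * q)"
proof -
  have "moment (\<lambda>y. y * ((y - s) * (y - t))) = (q - 1) * (0 * (q + 1) + (s * t) * q + (- (s + t)) * q\<^sup>2 + 2 * 1 * q\<^sup>2 + 2 * 0 * q^3)"
    by (rule moment_quartic) (simp add: algebra_simps power2_eq_square power3_eq_cube)
  then show ?thesis by (simp add: algebra_simps power2_eq_square power3_eq_cube)
qed

lemma moment_m2: "moment (\<lambda>y. y\<^sup>2 * ((y - s) * (y - t))) = (q - 1) * (2 * q^3 - 2 * (s + t) * q\<^sup>2 + s * t * q\<^sup>2)"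
proof -
  have "moment (\<lambda>y. y\<^sup>2 * ((y - s) * (y - t))) = (q - 1) * (0 * (q + 1) + 0 * q + (s * t) * q\<^sup>2 + 2 * (- (s + t)) * q\<^sup>2 + 2 * 1 * q^3)"
    by (rule moment_quartic) (simp add: algebra_simps power2_eq_square power3_eq_cube power4_eq_xxxx)
  then show ?thesis by (simp add: algebra_simps power2_eq_square power3_eq_cube)
qed

definition "s1 = y1 + y2 + y3"
definition "s2 = y1 * y2 + y1 * y3 + y2 * y3"
text \<open>\<open>psi\<close> is the drop from \<open>0\<close> to a unit vector of the Fourier transform of
  \<open>(y - y1) (y - y2) (y - y3)\<close>; the bounds in \<open>psi_large\<close> exceed all other drops between
  neighbouring words outside the code.\<close>
definition "psi = - (s1 * (q - 2) + y1 * y2 * y3)"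

definition "psi_large \<longleftrightarrow> psi > 2 * (q - 2) + 2 * s1 \<and> psi > 2 * (q - 2) - 2 * s1
    \<and> psi > 3 * q - 8 + s2 \<and> psi > - q - 2 - s2"

lemma scale_pos: "(q - 1) * q\<^sup>2 > 0"
  using q_ge by simp

text \<open>The cubic vanishes at \<open>y1\<close>, \<open>y2\<close>, \<open>y3\<close>, so the
  weighted moment is a single positive term at \<open>y4\<close>.\<close>

lemma psi_pos: "psi > 0"
proof -
  have "moment (\<lambda>y. (q - y) * ((y - y1) * (y - y2) * (y - y3))) = n4 * ((q - y4) * ((y4 - y1) * (y4 - y2) * (y4 - y3)))"
    by (simp add: moment_def)
  also have "\<dots> > 0" using n_pos order bounds by (intro mult_pos_pos) auto
  finally have "(q - 1) * q\<^sup>2 * psi > 0" unfolding moment_cubic psi_def s1_def .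
  then show ?thesis using scale_pos by (rule zero_less_mult_pos)
qed

text \<open>With the positive weights \<open>q - y\<close> the mean of the values is
  \<open>0\<close>, so they cannot all lie on one side of it.\<close>

lemma y1_neg: "y1 < 0" and y4_pos: "y4 > 0"
proof -
  have less: "y1 < q" "y2 < q" "y3 < q" using order bounds by auto
  show "y1 < 0"
  proof (rule ccontr)
    assume "\<not> y1 < 0"
    then have "n1 * ((q - y1) * y1) \<ge> 0" "n2 * ((q - y2) * y2) > 0" "n3 * ((q - y3) * y3) > 0" "n4 * ((q - y4) * y4) > 0"
      using n_pos order bounds less by (auto intro!: mult_pos_pos mult_nonneg_nonneg)
    then show False using moment_mean unfolding moment_def by linarith
  qed
  show "y4 > 0"
  proof (rule ccontr)
    assume "\<not> y4 > 0"
    then have "n1 * ((q - y1) * y1) < 0" "n2 * ((q - y2) * y2) < 0" "n3 * ((q - y3) * y3) < 0" "n4 * ((q - y4) * y4) \<le> 0"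
      using n_pos order bounds less
      by (auto intro!: mult_pos_neg mult_nonneg_nonpos)
    then show False using moment_mean unfolding moment_def by linarith
  qed
qed

text \<open>The quadratic with the two middle values as roots is positive at the two outer
  ones.\<close>

lemma quad_middle: "q - 2 + y2 * y3 > 0"
proof -
  have "moment (\<lambda>y. (q - y) * ((y - y2) * (y - y3))) = n1 * ((q - y1) * ((y1 - y2) * (y1 - y3))) + n4 * ((q - y4) * ((y4 - y2) * (y4 - y3)))"
    by (simp add: moment_def)
  also have "\<dots> > 0" using n_pos order bounds
    by (intro add_pos_pos mult_pos_pos[of n1] mult_pos_pos[of "q - _"] mult_neg_neg mult_pos_pos[of n4] mult_pos_pos[of "y4 - _"]) auto
  finally have "(q - 1) * q\<^sup>2 * (q - 2 + y2 * y3) > 0" unfolding moment_quad .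
  then show ?thesis using scale_pos by (rule zero_less_mult_pos)
qed

lemma quad_left: "q - 2 + y1 * y2 > 0"
proof -
  have "moment (\<lambda>y. (q - y) * ((y - y1) * (y - y2))) = n3 * ((q - y3) * ((y3 - y1) * (y3 - y2))) + n4 * ((q - y4) * ((y4 - y1) * (y4 - y2)))"
    by (simp add: moment_def)
  also have "\<dots> > 0" using n_pos order bounds
    by (intro add_pos_pos mult_pos_pos mult_neg_neg) auto
  finally have "(q - 1) * q\<^sup>2 * (q - 2 + y1 * y2) > 0" unfolding moment_quad .
  then show ?thesis using scale_pos by (rule zero_less_mult_pos)
qed

text \<open>Multiplying by \<open>(y - y2) * (y - y3)\<close> leaves positive weights
  \<open>u\<close> at \<open>y1\<close> and \<open>v\<close> at \<open>y4\<close>; this is the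
  Cauchy-Schwarz inequality for them.\<close>

lemma cauchy_middle:
  "(q\<^sup>2 - (y2 + y3) * q + y2 * y3 * (q + 1)) * (2 * q^3 - 2 * (y2 + y3) * q\<^sup>2 + y2 * y3 * q\<^sup>2)
    \<ge> (2 * q\<^sup>2 - (y2 + y3) * q\<^sup>2 + y2 * y3 * q)\<^sup>2"
proof -
  define u where "u = n1 * ((y1 - y2) * (y1 - y3))"
  define v where "v = n4 * ((y4 - y2) * (y4 - y3))"
  have pos: "u > 0" "v > 0" using n_pos order unfolding u_def v_def
    by (simp_all add: mult_neg_neg)
  have m: "moment (\<lambda>y. (y - y2) * (y - y3)) = u + v" "moment (\<lambda>y. y * ((y - y2) * (y - y3))) = u * y1 + v * y4"
    "moment (\<lambda>y. y\<^sup>2 * ((y - y2) * (y - y3))) = u * y1\<^sup>2 + v * y4\<^sup>2"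
    unfolding moment_def u_def v_def by (simp_all add: algebra_simps)
  have "(u + v) * (u * y1\<^sup>2 + v * y4\<^sup>2) - (u * y1 + v * y4)\<^sup>2 = u * v * (y1 - y4)\<^sup>2"
    by (simp add: algebra_simps power2_eq_square)
  moreover have "u * v * (y1 - y4)\<^sup>2 \<ge> 0" using pos by simp
  ultimately have "(u * y1 + v * y4)\<^sup>2 \<le> (u + v) * (u * y1\<^sup>2 + v * y4\<^sup>2)" by linarith
  then have "(q - 1)\<^sup>2 * (2 * q\<^sup>2 - (y2 + y3) * q\<^sup>2 + y2 * y3 * q)\<^sup>2
      \<le> (q - 1)\<^sup>2 * ((q\<^sup>2 - (y2 + y3) * q + y2 * y3 * (q + 1)) * (2 * q^3 - 2 * (y2 + y3) * q\<^sup>2 + y2 * y3 * q\<^sup>2))"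
    unfolding m[symmetric] moment_m0 moment_m1 moment_m2 by (simp add: power2_eq_square mult_ac)
  then show ?thesis using q_ge by simp
qed

text \<open>Multiplying by \<open>(y - y1) * (y - y2)\<close> leaves positive weights at
  \<open>y3\<close> and \<open>y4\<close>, where \<open>y * (y - y3)\<close> is nonnegative.\<close>

lemma outer_right: "y3 * (2 * q\<^sup>2 - (y1 + y2) * q\<^sup>2 + y1 * y2 * q) \<le> 2 * q^3 - 2 * (y1 + y2) * q\<^sup>2 + y1 * y2 * q\<^sup>2"
  if "y3 > 0"
proof -
  define u where "u = n3 * ((y3 - y1) * (y3 - y2))"
  define v where "v = n4 * ((y4 - y1) * (y4 - y2))"
  have pos: "u > 0" "v > 0" using n_pos order unfolding u_def v_def
    by (auto intro!: mult_pos_pos mult_neg_neg)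
  have m: "moment (\<lambda>y. y * ((y - y1) * (y - y2))) = u * y3 + v * y4"
    "moment (\<lambda>y. y\<^sup>2 * ((y - y1) * (y - y2))) = u * y3\<^sup>2 + v * y4\<^sup>2"
    unfolding moment_def u_def v_def by (simp_all add: algebra_simps)
  have "(u * y3\<^sup>2 + v * y4\<^sup>2) - y3 * (u * y3 + v * y4) = v * (y4 * (y4 - y3))"
    by (simp add: algebra_simps power2_eq_square)
  moreover have "v * (y4 * (y4 - y3)) \<ge> 0" using pos order y4_pos by simp
  ultimately have "y3 * (u * y3 + v * y4) \<le> u * y3\<^sup>2 + v * y4\<^sup>2" by linarith
  then have "(q - 1) * (y3 * (2 * q\<^sup>2 - (y1 + y2) * q\<^sup>2 + y1 * y2 * q))
      \<le> (q - 1) * (2 * q^3 - 2 * (y1 + y2) * q\<^sup>2 + y1 * y2 * q\<^sup>2)"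
    unfolding m[symmetric] moment_m1 moment_m2 by (simp add: mult_ac)
  then show ?thesis using q_ge by simp
qed

text \<open>The moment of the quartic with all four values as roots vanishes.\<close>

lemma outer_relation:
  "(2 * q^3 - 2 * (y1 + y2) * q\<^sup>2 + y1 * y2 * q\<^sup>2) - (y3 + y4) * (2 * q\<^sup>2 - (y1 + y2) * q\<^sup>2 + y1 * y2 * q)
    + y3 * y4 * (q\<^sup>2 - (y1 + y2) * q + y1 * y2 * (q + 1)) = 0"
proof -
  have "moment (\<lambda>y. y\<^sup>2 * ((y - y1) * (y - y2))) - (y3 + y4) * moment (\<lambda>y. y * ((y - y1) * (y - y2)))
      + y3 * y4 * moment (\<lambda>y. (y - y1) * (y - y2)) = 0"
    unfolding moment_def by (simp add: algebra_simps power2_eq_square)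
  then have "(q - 1) * ((2 * q^3 - 2 * (y1 + y2) * q\<^sup>2 + y1 * y2 * q\<^sup>2) - (y3 + y4) * (2 * q\<^sup>2 - (y1 + y2) * q\<^sup>2 + y1 * y2 * q)
    + y3 * y4 * (q\<^sup>2 - (y1 + y2) * q + y1 * y2 * (q + 1))) = 0"
    unfolding moment_m0 moment_m1 moment_m2 by (simp add: right_diff_distrib distrib_left mult_ac)
  then show ?thesis using q_ge by simp
qed

lemma middle_moment_pos: "q\<^sup>2 - (y2 + y3) * q + y2 * y3 * (q + 1) > 0"
proof -
  have "moment (\<lambda>y. (y - y2) * (y - y3)) = n1 * ((y1 - y2) * (y1 - y3)) + n4 * ((y4 - y2) * (y4 - y3))"
    by (simp add: moment_def)
  also have "\<dots> > 0" using n_pos order by (simp add: mult_neg_neg add_pos_pos)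
  finally show ?thesis unfolding moment_m0 using q_ge by (simp add: zero_less_mult_iff)
qed

section \<open>Lower bounds for \<open>psi\<close>, according to the signs of the values\<close>

lemma dvd_bounds: "y1 \<ge> 4 - q" "y4 \<le> q - 4" "y1 \<le> -4" "y2 \<ge> y1 + 4" "y3 \<ge> y2 + 4" "y4 \<ge> y3 + 4"
proof -
  have step: "x + 4 \<le> y" if "4 dvd x" "4 dvd y" "x < y" for x y :: int
    using zdvd_imp_le[OF dvd_diff[OF that(2,1)]] that(3) by simp
  have q4: "4 dvd q" using dvd16_q by (rule dvd_trans[rotated]) simp
  show "y1 \<ge> 4 - q" using step[of "-q" y1] q4 dvd4 bounds by simp
  show "y4 \<le> q - 4" using step[of y4 q] q4 dvd4 bounds by simp
  show "y1 \<le> -4" using step[of y1 0] dvd4 y1_neg by simp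
  show "y2 \<ge> y1 + 4" "y3 \<ge> y2 + 4" "y4 \<ge> y3 + 4" using step dvd4 order by simp_all
qed

text \<open>The divisibility \<open>4 q | y1 y2 y3\<close> turns positivity of \<open>psi\<close> into \<open>psi \<ge> 4 q + 2 s1\<close>,
  except when \<open>j = 0\<close>.\<close>
lemma psi_via_J: obtains j where "psi = 2 * s1 + q * (4 * j)" "q * (4 * j) = - (q * s1 + y1 * y2 * y3)" "j \<ge> 0"
proof -
  obtain t where t: "y1 * y2 * y3 = 4 * q * t" using dvd_prod by (elim dvdE)
  have "4 dvd s1" unfolding s1_def using dvd4 by (intro dvd_add)
  then obtain k where k: "s1 = 4 * k" by (elim dvdE)
  have 1: "psi = 2 * s1 + q * (4 * (- k - t))" unfolding psi_def t by (simp add: k algebra_simps)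
  have 2: "q * (4 * (- k - t)) = - (q * s1 + y1 * y2 * y3)" unfolding t k by (simp add: algebra_simps)
  \<comment> \<open>A negative \<open>- k - t\<close> together with \<open>psi > 0\<close> would
    force \<open>s1 > 2 * q\<close>, but \<open>y1\<close> is negative and the other two values are
    below \<open>q\<close>.\<close>
  have "- k - t \<ge> 0"
  proof (rule ccontr)
    assume "\<not> - k - t \<ge> 0"
    then have "q * (4 * (- k - t)) \<le> q * (-4)" using q_ge by (intro mult_left_mono) auto
    then have "s1 > 2 * q" using 1 psi_pos by linarith
    then show False unfolding s1_def using y1_neg order bounds by linarith
  qed
  then show ?thesis using that[OF 1 2] by blast
qed

text \<open>With the signs reversed, \<open>psi\<close> is a sum of nonnegative terms. The term
  \<open>s * (q - 2)\<close> with \<open>s \<ge> 12\<close> beats both bounds in \<open>s1\<close>,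
  and the splitting \<open>a6\<close> handles the comparison with \<open>s2\<close>.\<close>

lemma psi_large_if_y3_nonpos: "psi_large" if "y3 \<le> 0"
proof -
  define Y1 where "Y1 = - y1"
  define Y2 where "Y2 = - y2"
  define Y3 where "Y3 = - y3"
  have ys: "y1 = - Y1" "y2 = - Y2" "y3 = - Y3" by (simp_all add: Y1_def Y2_def Y3_def)
  have b: "Y3 \<ge> 0" "Y2 \<ge> 4" "Y1 \<ge> 8" "Y1 \<le> q - 4" using dvd_bounds that unfolding ys by auto
  define s where "s = Y1 + Y2 + Y3"
  have s: "s1 = - s" unfolding s1_def s_def by (simp add: ys)
  have s12: "s \<ge> 12" using b by (simp add: s_def)
  have psi: "psi = s * (q - 2) + Y1 * Y2 * Y3" unfolding psi_def s by (simp add: ys)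
  have nn: "Y1 * Y2 * Y3 \<ge> 0" using b by simp
  have a1: "s * (q - 4) \<ge> 12 * (q - 4)" using s12 q_ge by (intro mult_right_mono) auto
  have a2: "s * (q - 2) = s * (q - 4) + 2 * s" by (simp add: algebra_simps)
  have s2: "s2 = Y1 * Y2 + Y1 * Y3 + Y2 * Y3" unfolding s2_def by (simp add: ys)
  have a3: "(q - 2 - Y1) * (Y2 + Y3) \<ge> 0" using b by simp
  have a4: "Y2 * Y3 * (Y1 - 1) \<ge> 0" using b by simp
  have a5: "(q - 2) * Y1 \<ge> (q - 2) * 8" using b q_ge by (intro mult_left_mono) auto
  have a6: "psi - s2 = (q - 2) * Y1 + (q - 2 - Y1) * (Y2 + Y3) + Y2 * Y3 * (Y1 - 1)"
    unfolding psi s2 s_def by (simp add: algebra_simps)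
  have "psi > 2 * (q - 2) + 2 * s1"
    using psi nn a1 a2 s s12 q_ge by (simp add: algebra_simps)
  moreover have "psi > 2 * (q - 2) - 2 * s1"
    using psi nn a1 a2 s s12 q_ge by (simp add: algebra_simps)
  moreover have "psi > 3 * q - 8 + s2"
  proof -
    have "psi - s2 \<ge> (q - 2) * 8" unfolding a6 using a3 a4 a5 by simp
    then show ?thesis using q_ge by simp
  qed
  moreover have "s2 \<ge> 0" using b by (simp add: s2)
  then have "psi > - q - 2 - s2" using psi_pos q_ge by linarith
  ultimately show ?thesis by (simp add: psi_large_def)
qed

text \<open>The relation \<open>Y * c = q * (a + 4 * j)\<close> with \<open>j \<ge> 1\<close> bounds
  \<open>Y * c\<close> from below, and Cauchy-Schwarz bounds \<open>c\<close> below by a quadratic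
  in \<open>a\<close>. Where necessary an inequality is multiplied by \<open>c\<close> so that
  \<open>Y\<close> enters only through \<open>Y * c\<close>.\<close>

lemma psi_large_if_y2_nonpos: "psi_large" if "y2 \<le> 0" "y3 > 0"
proof -
  define Y where "Y = - y1"
  define b where "b = - (y2 * y3)"
  define c where "c = q - b"
  define a where "a = y2 + y3"
  obtain k2 k3 where k: "y2 = 4 * k2" "y3 = 4 * k3" using dvd4 by (elim dvdE)
  obtain k where kq: "q = 16 * k" using dvd16_q by (elim dvdE)
  have c16: "c = 16 * (k + k2 * k3)" by (simp add: c_def b_def k kq algebra_simps)
  have "c > 2" using quad_middle by (simp add: c_def b_def)
  then have c_ge: "c \<ge> 16" using zdvd_imp_le[of 16 c] c16 by simp
  have c_le: "c \<le> q" using that by (simp add: c_def b_def mult_nonpos_nonneg)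
  have Y: "Y \<ge> 4" "Y \<le> q - 4" using dvd_bounds by (auto simp: Y_def)
  have a4: "a = 4 * (k2 + k3)" by (simp add: a_def k)
  have a_cases: "a \<ge> 4 \<or> a = 0 \<or> a \<le> -4" unfolding a4 by presburger
  have psi: "psi = Y * (c - 2) - a * (q - 2)" by (simp add: psi_def s1_def Y_def c_def b_def a_def algebra_simps)
  have s1: "s1 = a - Y" by (simp add: s1_def a_def Y_def)
  have s2: "s2 = - (q - c) - Y * a" by (simp add: s2_def c_def b_def Y_def a_def algebra_simps)
  obtain j where j: "psi = 2 * s1 + q * (4 * j)" "q * (4 * j) = - (q * s1 + y1 * y2 * y3)" "j \<ge> 0" by (rule psi_via_J)
  have Yc: "Y * c = q * a + q * (4 * j)" unfolding j(2) s1 by (simp add: Y_def c_def b_def a_def algebra_simps)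
  \<comment> \<open>For \<open>j = 0\<close> the relation gives \<open>a \<le> Y\<close>, that is
    \<open>s1 \<le> 0\<close>, and then \<open>psi = 2 * s1\<close> is not positive.\<close>
  have "j \<noteq> 0"
  proof
    assume "j = 0"
    then have "q * a = Y * c" using Yc by simp
    also have "\<dots> \<le> Y * q" using c_le Y by (intro mult_left_mono) auto
    finally have "a \<le> Y" using q_ge by (simp add: mult.commute)
    then show False using psi_pos j(1) \<open>j = 0\<close> s1 by simp
  qed
  then have "q * 4 \<le> q * (4 * j)" using j(3) q_ge by (intro mult_left_mono) auto
  then have Yc4: "Y * c \<ge> q * a + 4 * q" using Yc by linarith
  \<comment> \<open>Up to a common factor the moments in \<open>cauchy_middle\<close> are
    \<open>X\<close>, \<open>q * (q + c - q * a)\<close> and \<open>q^2 * (q + c - 2 * a)\<close>;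
    with \<open>c \<le> q\<close> the factor \<open>q^2\<close> cancels.\<close>
  have c_big: "2 * (c - a) \<ge> (a - 2)\<^sup>2" if "a \<ge> 4"
  proof -
    define X where "X = q * (c - a) - q + c"
    have e0: "q\<^sup>2 - (y2 + y3) * q + y2 * y3 * (q + 1) = X"
      unfolding X_def c_def b_def a_def by (simp add: algebra_simps power2_eq_square)
    have e1: "2 * q\<^sup>2 - (y2 + y3) * q\<^sup>2 + y2 * y3 * q = q * (q + c - q * a)"
      unfolding c_def b_def a_def by (simp add: algebra_simps power2_eq_square)
    have e2: "2 * q^3 - 2 * (y2 + y3) * q\<^sup>2 + y2 * y3 * q\<^sup>2 = q\<^sup>2 * (q + c - 2 * a)"
      unfolding c_def b_def a_def by (simp add: algebra_simps power2_eq_square power3_eq_cube)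
    have "q\<^sup>2 * (q + c - q * a)\<^sup>2 \<le> q\<^sup>2 * (X * (q + c - 2 * a))"
      using cauchy_middle unfolding e0 e1 e2 by (simp add: power_mult_distrib mult_ac)
    then have 1: "(q + c - q * a)\<^sup>2 \<le> X * (q + c - 2 * a)" using q_ge by simp
    have X: "X > 0" using middle_moment_pos unfolding e0 .
    have "X * (q + c - 2 * a) \<le> X * (2 * q)" using X c_le that by (intro mult_left_mono) auto
    also have "\<dots> \<le> (q * (c - a)) * (2 * q)" using c_le q_ge by (intro mult_right_mono) (auto simp: X_def)
    finally have 2: "(q + c - q * a)\<^sup>2 \<le> q\<^sup>2 * (2 * (c - a))" using 1 by (simp add: power2_eq_square mult_ac)
    have "(q * (a - 2))\<^sup>2 \<le> (q * a - q - c)\<^sup>2"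
      using c_le that q_ge by (intro power_mono) (auto simp: algebra_simps)
    also have "\<dots> = (q + c - q * a)\<^sup>2" by (simp add: power2_eq_square algebra_simps)
    finally have "q\<^sup>2 * (a - 2)\<^sup>2 \<le> q\<^sup>2 * (2 * (c - a))" using 2 by (simp add: power_mult_distrib)
    then show ?thesis using q_ge by simp
  qed
  \<comment> \<open>The quadratic bound suffices from \<open>a = 12\<close> on. At
    \<open>a = 8\<close> it gives \<open>c \<ge> 26\<close>, which rounds up to \<open>32\<close> as
    \<open>c\<close> is a multiple of \<open>16\<close>; at \<open>a = 4\<close> already
    \<open>c \<ge> 16\<close> is enough.\<close>
  have c_lin: "c \<ge> 2 * a + 8 \<and> 4 * c \<ge> (a + 2) * (a + 4)" if "a \<ge> 4"
  proof -
    have "k2 + k3 = 1 \<or> k2 + k3 = 2 \<or> k2 + k3 \<ge> 3" using a4 \<open>a \<ge> 4\<close> by auto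
    then consider "a = 4" | "a = 8" | "a \<ge> 12" unfolding a4 by auto
    then show ?thesis
    proof cases
      case 2
      then have "c \<ge> 26" using c_big[OF that] by simp
      moreover obtain t where "c = 16 * t" using c16 by blast
      ultimately have "c \<ge> 32" by simp
      then show ?thesis using 2 by simp
    next
      case 3
      define A where "A = a * a"
      have "2 * c \<ge> A - 2 * a + 4" using c_big[OF that] by (simp add: A_def power2_eq_square algebra_simps)
      moreover have "12 * a \<le> A" using 3 by (simp add: A_def)
      moreover have "(a + 2) * (a + 4) = A + 6 * a + 8" by (simp add: A_def algebra_simps)
      ultimately show ?thesis using 3 by linarith
    qed (use c_ge in auto)
  qed
  have "psi > 2 * (q - 2) + 2 * s1"
    using Yc4 q_ge unfolding psi s1 by (simp add: algebra_simps)
  moreover have "psi > 2 * (q - 2) - 2 * s1"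
  proof -
    have e: "psi - (2 * (q - 2) - 2 * s1) = Y * (c - 4) - a * (q - 4) - 2 * q + 4"
      unfolding psi s1 by (simp add: algebra_simps)
    have "Y * (c - 4) - a * (q - 4) - 2 * q + 4 > 0"
    proof (cases "a < 0")
      case True
      then have "a \<le> -4" using a_cases by simp
      then have "a * (q - 4) \<le> (-4) * (q - 4)" using q_ge by (intro mult_right_mono) auto
      also have "\<dots> = 16 - 4 * q" by simp
      finally have "a * (q - 4) \<le> 16 - 4 * q" .
      moreover have "Y * (c - 4) \<ge> 0" using Y c_ge by simp
      ultimately show ?thesis using q_ge by simp
    next
      case False
      then have ca: "c \<ge> 2 * a + 8" using c_lin a_cases c_ge by (cases "a = 0") auto
      have "(q * a + 4 * q) * (c - 4) \<le> (Y * c) * (c - 4)" using Yc4 c_ge by (intro mult_right_mono) auto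
      moreover have "2 * q * (c - 2 * a - 8) \<ge> 0" using q_ge ca by simp
      moreover have "a * c \<ge> 0" using False c_ge by simp
      moreover have "c * (Y * (c - 4) - a * (q - 4) - 2 * q + 4)
        = (Y * c) * (c - 4) - (q * a + 4 * q) * (c - 4) + 2 * q * (c - 2 * a - 8) + 4 * (a * c) + 4 * c"
        by (simp add: algebra_simps)
      ultimately have "c * (Y * (c - 4) - a * (q - 4) - 2 * q + 4) > 0" using c_ge by linarith
      then show ?thesis by (rule zero_less_mult_pos) (use c_ge in simp)
    qed
    then show ?thesis using e by linarith
  qed
  moreover have "psi > 3 * q - 8 + s2"
  proof -
    have e: "psi - (3 * q - 8 + s2) = Y * c - a * q - 2 * q + 8 + 2 * a - c + Y * a - 2 * Y"
      unfolding psi s2 by (simp add: algebra_simps)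
    consider "a \<ge> 4" | "a = 0" | "a \<le> -4" using a_cases by blast
    then have "Y * c - a * q - 2 * q + 8 + 2 * a - c + Y * a - 2 * Y > 0"
    proof cases
      case 1
      then have "Y * (a - 2) \<ge> 0" using Y by simp
      then show ?thesis using Yc4 1 c_le q_ge by (simp add: algebra_simps)
    next
      case 2
      have "Y * (c - 16) \<ge> 0" "(Y - 4) * c \<ge> 0" using Y c_ge by simp_all
      then show ?thesis using Yc4 2 q_ge by (simp add: algebra_simps)
    next
      case 3
      have "(Y - 1) * (c - 16) \<ge> 0" "(- a - 4) * (q - 2 - Y) \<ge> 0" using 3 Y c_ge
        by (auto intro!: mult_nonneg_nonneg)
      then show ?thesis using Y q_ge by (simp add: algebra_simps)
    qed
    then show ?thesis using e by linarith
  qed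
  moreover have "psi > - q - 2 - s2"
  proof (cases "a \<le> 0")
    case True
    then have "Y * a \<le> 0" using Y by (simp add: mult_nonneg_nonpos)
    then show ?thesis using psi_pos c_ge unfolding s2 by linarith
  next
    case False
    then have a: "a \<ge> 4" using a_cases by simp
    have e: "psi - (- q - 2 - s2) = Y * c - 2 * Y - a * q + 2 * a + 2 + c - Y * a"
      unfolding psi s2 by (simp add: algebra_simps)
    have "(q * a + 4 * q) * (c - 2 - a) \<le> (Y * c) * (c - 2 - a)" using Yc4 c_lin[OF a] a by (intro mult_right_mono) auto
    moreover have "q * (4 * c - (a + 2) * (a + 4)) \<ge> 0" using q_ge c_lin[OF a] by simp
    moreover have "c * (2 * a + 2 + c) > 0" using a c_ge by simp
    moreover have "c * (Y * c - 2 * Y - a * q + 2 * a + 2 + c - Y * a)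
        = (Y * c) * (c - 2 - a) - (q * a + 4 * q) * (c - 2 - a) + q * (4 * c - (a + 2) * (a + 4)) + c * (2 * a + 2 + c)"
      by (simp add: algebra_simps)
    ultimately have "c * (Y * c - 2 * Y - a * q + 2 * a + 2 + c - Y * a) > 0" by linarith
    then have "Y * c - 2 * Y - a * q + 2 * a + 2 + c - Y * a > 0" by (rule zero_less_mult_pos) (use c_ge in simp)
    then show ?thesis using e by linarith
  qed
  ultimately show ?thesis by (simp add: psi_large_def)
qed

text \<open>Here \<open>q * d = q * (4 * j) + y3 * c\<close>. The case \<open>j = 0\<close> is
  excluded 2-adically, and \<open>j \<ge> 1\<close> gives \<open>psi \<ge> 4 * q + 2 * s1\<close>;
  the last bound also needs \<open>outer_right\<close>.\<close>

lemma psi_large_if_y2_pos: "psi_large" if "y2 > 0"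
proof -
  define Y where "Y = - y1"
  define b where "b = Y * y2"
  define c where "c = q - b"
  define d where "d = Y - y2"
  obtain k1 k2 where k: "y1 = 4 * k1" "y2 = 4 * k2" using dvd4 by (elim dvdE)
  obtain k where kq: "q = 16 * k" using dvd16_q by (elim dvdE)
  have c16: "c = 16 * (k + k1 * k2)" by (simp add: c_def b_def Y_def k kq algebra_simps)
  have "c > 2" using quad_left by (simp add: c_def b_def Y_def)
  then have c_ge: "c \<ge> 16" using zdvd_imp_le[of 16 c] c16 by simp
  have Y: "Y \<ge> 4" "Y \<le> q - 4" using dvd_bounds by (auto simp: Y_def)
  have b_pos: "b > 0" using Y that by (simp add: b_def)
  have c_le: "c \<le> q" using b_pos by (simp add: c_def)
  have y2: "y2 \<ge> 4" using that k by simp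
  then have y3: "y3 \<ge> 8" using dvd_bounds by linarith
  have s1: "s1 = y3 - d" by (simp add: s1_def d_def Y_def)
  have s2: "s2 = - b - d * y3" by (simp add: s2_def b_def d_def Y_def algebra_simps)
  obtain j where j: "psi = 2 * s1 + q * (4 * j)" "q * (4 * j) = - (q * s1 + y1 * y2 * y3)" "j \<ge> 0" by (rule psi_via_J)
  have qd: "q * d = q * (4 * j) + y3 * c" unfolding j(2) s1 by (simp add: Y_def c_def b_def d_def algebra_simps)
  have "j \<noteq> 0"
  proof
    assume "j = 0"
    then have yc: "y3 * c = q * d" using qd by simp
    then have "q * d > 0" using y3 c_ge by (metis mult_pos_pos less_le_trans zero_less_numeral)
    then have "d > 0" using q_ge by (simp add: zero_less_mult_iff)
    define D where "D = c * (q + c) + b * d - q * d\<^sup>2"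
    have e: "y1 + y2 = - d" "y1 * y2 = - b" by (simp_all add: d_def Y_def b_def)
    \<comment> \<open>Multiplying \<open>outer_relation\<close> by \<open>c\<close> and replacing
      \<open>y3 * c\<close> by \<open>q * d\<close> eliminates \<open>y3\<close>; what remains is
      the equation refuted by \<open>two_adic_obstruction\<close>.\<close>
    define A where "A = 2 * q^3 + 2 * d * q\<^sup>2 - b * q\<^sup>2"
    define B where "B = 2 * q\<^sup>2 + d * q\<^sup>2 - b * q"
    define C where "C = q\<^sup>2 + d * q - b * (q + 1)"
    have "A - (y3 + y4) * B + y3 * y4 * C = 0" using outer_relation unfolding e A_def B_def C_def by simp
    then have "c * A - (y3 * c + y4 * c) * B + (y3 * c) * y4 * C = 0" by algebra
    then have "c * A - (q * d + y4 * c) * B + (q * d) * y4 * C = 0" unfolding yc .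
    moreover have "c * A - (q * d + y4 * c) * B + (q * d) * y4 * C = q * ((q - y4) * D - 2 * q * d * b)"
    proof -
      have b: "b = q - c" by (simp add: c_def)
      show ?thesis unfolding A_def B_def C_def D_def b by (simp add: algebra_simps power2_eq_square power3_eq_cube)
    qed
    ultimately have "(q - y4) * D = 2 * q * d * b" using q_ge by simp
    then show False using two_adic_obstruction[OF q b_pos c_def _ \<open>d > 0\<close> _ _ yc y4_pos bounds(2)]
      c_ge y3 order bounds unfolding D_def by auto
  qed
  then have j1: "j \<ge> 1" using j(3) by simp
  have qj: "q * (4 * j) \<ge> q * 4" using j1 q_ge by (intro mult_left_mono) auto
  have qj4: "(q - 4) * (4 * j) \<ge> (q - 4) * 4" using j1 q_ge by (intro mult_left_mono) auto
  have yc: "y3 * c \<le> y3 * q" using c_le y3 by (intro mult_left_mono) auto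
  have yc0: "y3 * c > 0" using y3 c_ge by simp
  have "q * d > 0" using qd qj yc0 q_ge by linarith
  then have d: "d > 0" using q_ge by (simp add: zero_less_mult_iff)
  define Q where "Q = q * (4 * j)"
  have Q: "psi = 2 * s1 + Q" "Q \<ge> 4 * q" using j(1) qj by (simp_all add: Q_def mult.commute)
  then have "psi > 2 * (q - 2) + 2 * s1" using q_ge by simp
  moreover have "psi > 2 * (q - 2) - 2 * s1"
  proof -
    have "q * d \<le> q * (4 * j + y3)" using qd yc by (simp add: algebra_simps)
    then have "d \<le> 4 * j + y3" using q_ge by simp
    then show ?thesis using j(1) qj4 q_ge unfolding s1 by (simp add: algebra_simps)
  qed
  moreover have "psi > 3 * q - 8 + s2"
  proof -
    define P where "P = d * y3"
    have "2 * d \<le> P" using d y3 by (simp add: P_def)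
    moreover have "s2 = - b - P" by (simp add: s2 P_def)
    ultimately show ?thesis using Q y3 b_pos q_ge s1 by linarith
  qed
  moreover have "psi > - q - 2 - s2"
  proof -
    have e: "y1 + y2 = - d" "y1 * y2 = - b" by (simp_all add: d_def Y_def b_def)
    have "q * (y3 * (q + c + d * q)) \<le> q * (q * (q + c + 2 * d))"
      using outer_right y3 unfolding e by (simp add: c_def algebra_simps power2_eq_square power3_eq_cube)
    then have 1: "y3 * (q + c + d * q) \<le> q * (q + c + 2 * d)" using q_ge by simp
    \<comment> \<open>After multiplication by \<open>q\<close> and elimination of
      \<open>q * d\<close>, the difference is the slack of \<open>outer_right\<close>, plus a
      nonnegative multiple of \<open>q - c\<close>, plus a term that is positive for
      \<open>j \<ge> 1\<close>.\<close>
    have "q * (psi - (- q - 2 - s2)) = 2 * q * y3 - 2 * (q * d) + q * (q * (4 * j)) + 2 * q + q * c - q * d * y3"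
      unfolding j(1) s1 s2 by (simp add: c_def algebra_simps)
    also have "\<dots> = (q * (q + c + 2 * d) - y3 * (q + c + d * q)) + 3 * q * y3 - 4 * (q * d) + q * (q * (4 * j)) + 2 * q - q * q + y3 * c"
      by (simp add: algebra_simps)
    also have "\<dots> = (q * (q + c + 2 * d) - y3 * (q + c + d * q)) + 3 * (y3 * q - y3 * c) + q * ((q - 4) * (4 * j) + 2 - q)"
      unfolding qd by (simp add: algebra_simps)
    finally have 2: "q * (psi - (- q - 2 - s2)) = \<dots>" .
    have "q * ((q - 4) * (4 * j) + 2 - q) > 0" using q_ge qj4 by simp
    moreover have "q * (q + c + 2 * d) - y3 * (q + c + d * q) \<ge> 0" "3 * (y3 * q - y3 * c) \<ge> 0" using 1 yc by simp_all
    ultimately have "q * (psi - (- q - 2 - s2)) > 0" unfolding 2 by (intro add_nonneg_pos add_nonneg_nonneg)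
    then show ?thesis using q_ge by (simp add: zero_less_mult_iff)
  qed
  ultimately show ?thesis by (simp add: psi_large_def)
qed

lemma psi_largeI: "psi_large"
  using psi_large_if_y3_nonpos psi_large_if_y2_nonpos psi_large_if_y2_pos by linarith

end

section \<open>Binary words and characters\<close>

lemma UNIV_bit: "UNIV = {0, 1 :: bit}"
  using bit_not_zero_iff by auto

instance bit :: finite
  by standard (simp add: UNIV_bit)

lemma CARD_bit: "CARD(bit) = 2"
  by (simp add: UNIV_bit)

lemma bit_add_eq_1: "(a + b :: bit) = 1 \<longleftrightarrow> (a = 1) \<noteq> (b = 1)"
  by (cases a; cases b) simp_all

lemma word_add_eq_1: "((x + y) $ i :: bit) = 1 \<longleftrightarrow> (x $ i = 1) \<noteq> (y $ i = 1)"
  by (simp only: vector_add_component bit_add_eq_1)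

lemma word_eqI:
  fixes x y :: "bit ^ 'n"
  assumes "\<And>i. x $ i = 1 \<longleftrightarrow> y $ i = 1"
  shows "x = y"
  unfolding vec_eq_iff using assms bit_not_one_iff by metis

lemma word_add_self [simp]: "x + x = (0 :: bit ^ 'n)"
  by (rule word_eqI) (simp add: word_add_eq_1 del: add_bit_eq_xor)

lemma word_add_cancel [simp]: "x + (x + y) = (y :: bit ^ 'n)"
  by (simp flip: add.assoc)

lemma word_minus_eq: "x - y = (x + y :: bit ^ 'n)"
  by (simp add: diff_eq_eq add.assoc)

lemma word_add_cancel_right [simp]: "x + y + y = (x :: bit ^ 'n)"
  by (simp add: add.assoc)

lemma word_add_eq_0_iff: "x + y = 0 \<longleftrightarrow> x = (y :: bit ^ 'n)"
  by (metis word_add_cancel word_add_self add.right_neutral)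

definition supp :: "bit ^ 'n \<Rightarrow> 'n set" where
  "supp x = {i. x $ i = 1}"

definition wt :: "bit ^ 'n::finite \<Rightarrow> nat" where
  "wt x = card (supp x)"

lemma supp_inject: "supp x = supp y \<longleftrightarrow> x = y"
  by (auto simp: supp_def set_eq_iff intro: word_eqI)

lemma supp_0 [simp]: "supp 0 = {}"
  by (simp add: supp_def)

lemma supp_add: "supp (x + y) = (supp x - supp y) \<union> (supp y - supp x)"
  by (auto simp: supp_def word_add_eq_1 simp del: add_bit_eq_xor vector_add_component)

lemma wt_0 [simp]: "wt 0 = 0"
  by (simp add: wt_def)

lemma wt_eq_0_iff: "wt x = 0 \<longleftrightarrow> x = 0"
  using supp_inject[of x 0] by (simp add: wt_def)

lemma wt_le: "wt (x :: bit ^ 'n::finite) \<le> CARD('n)"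
  unfolding wt_def by (rule card_mono) auto

lemma wt_add: "wt (x + y) + 2 * card (supp x \<inter> supp y) = wt x + wt y"
proof -
  have "wt (x + y) = card (supp x - supp y) + card (supp y - supp x)"
    unfolding wt_def supp_add by (rule card_Un_disjoint) auto
  moreover have "wt x = card (supp x - supp y) + card (supp x \<inter> supp y)"
    unfolding wt_def by (subst card_Un_disjoint[symmetric]) (auto intro!: arg_cong[where f = card])
  moreover have "wt y = card (supp y - supp x) + card (supp x \<inter> supp y)"
    unfolding wt_def by (subst card_Un_disjoint[symmetric]) (auto intro!: arg_cong[where f = card])
  ultimately show ?thesis by simp
qed

lemma hamming_dist_wt: "hamming_dist x y = wt (x + y)"
proof -
  have "{i. x $ i \<noteq> y $ i} = supp (x + y)"
    unfolding supp_def word_add_eq_1 using bit_not_one_iff by metis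
  then show ?thesis by (simp add: hamming_dist_def wt_def)
qed

abbreviation unit :: "'n \<Rightarrow> bit ^ 'n::finite" where
  "unit i \<equiv> axis i 1"

lemma supp_unit: "supp (unit i) = {i}"
  by (auto simp: supp_def axis_def)

lemma wt_unit: "wt (unit i) = 1"
  by (simp add: wt_def supp_unit)

lemma wt_eq_1: assumes "wt x = 1" obtains i where "x = unit i"
proof -
  obtain i where "supp x = {i}" using assms card_1_singletonE by (auto simp: wt_def)
  then show ?thesis using that supp_inject supp_unit by metis
qed

lemma wt_add_unit: "wt (x + unit i) = (if i \<in> supp x then wt x - 1 else wt x + 1)"
  using wt_add[of x "unit i"] by (cases "i \<in> supp x") (simp_all add: supp_unit wt_unit)

lemma bij_supp: "bij_betw supp {e :: bit ^ 'n::finite. wt e = k} {A. card A = k}"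
proof (rule bij_betwI[where g = "\<lambda>A. \<chi> i. if i \<in> A then 1 else 0"])
  show "supp \<in> {e :: bit ^ 'n. wt e = k} \<rightarrow> {A. card A = k}" by (auto simp: wt_def)
qed (auto simp: wt_def supp_def intro!: word_eqI split: if_splits)

lemma card_wt: "card {e :: bit ^ 'n::finite. wt e = k} = CARD('n) choose k"
proof -
  have "card {e :: bit ^ 'n. wt e = k} = card {A :: 'n set. card A = k}"
    by (rule bij_betw_same_card[OF bij_supp])
  then show ?thesis using n_subsets[of "UNIV :: 'n set" k] by simp
qed

section \<open>Characters of the group of binary words, and dual codes\<close>

definition chi :: "bit ^ 'n::finite \<Rightarrow> bit ^ 'n \<Rightarrow> int" where
  "chi u v = (\<Prod>i\<in>UNIV. if u $ i = 1 \<and> v $ i = 1 then -1 else 1)"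

lemma chi_add_right: "chi u (v + w) = chi u v * chi u w"
  unfolding chi_def prod.distrib[symmetric] word_add_eq_1 by (rule prod.cong) auto

lemma chi_commute: "chi u v = chi v u"
  unfolding chi_def by (rule prod.cong) auto

lemma chi_add_left: "chi (u + v) w = chi u w * chi v w"
  by (metis chi_add_right chi_commute)

lemma chi_0 [simp]: "chi u 0 = 1" "chi 0 u = 1"
  by (simp_all add: chi_def)

lemma chi_cases: "chi u v = 1 \<or> chi u v = -1"
proof -
  have "chi u v * chi u v = 1" using chi_add_right[of u v v] by simp
  then show ?thesis by (simp add: square_eq_1_iff)
qed

lemma chi_unit: "chi u (unit i) = (if u $ i = 1 then -1 else 1)"
proof -
  have "chi u (unit i) = (\<Prod>j\<in>UNIV. if j = i then (if u $ i = 1 then -1 else 1) else 1)"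
    unfolding chi_def by (rule prod.cong) (auto simp: axis_def)
  then show ?thesis by simp
qed

lemma sum_chi_unit: "(\<Sum>i\<in>UNIV. chi u (unit i)) = int CARD('n) - 2 * int (wt u)"
  for u :: "bit ^ 'n::finite"
proof -
  have "(\<Sum>i\<in>UNIV. chi u (unit i)) = (\<Sum>i\<in>UNIV. 1 - 2 * of_bool (i \<in> supp u))"
    by (rule sum.cong) (auto simp: chi_unit supp_def)
  also have "\<dots> = int CARD('n) - 2 * int (wt u)"
    by (simp add: sum_subtractf wt_def sum_distrib_left[symmetric] sum.If_cases of_bool_def)
  finally show ?thesis .
qed

lemma subspace_iff: "vec.subspace S \<longleftrightarrow> 0 \<in> S \<and> (\<forall>x\<in>S. \<forall>y\<in>S. x + y \<in> S)"
  for S :: "(bit ^ 'n) set"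
proof
  assume *: "0 \<in> S \<and> (\<forall>x\<in>S. \<forall>y\<in>S. x + y \<in> S)"
  show "vec.subspace S"
  proof (rule vec.subspaceI)
    fix c :: bit and x assume "x \<in> S"
    then show "c *s x \<in> S" using * by (cases c) auto
  qed (use * in auto)
qed (auto intro: vec.subspace_0 vec.subspace_add)

text \<open>Orthogonality of characters: translation by a word with character value
  \<open>-1\<close> permutes \<open>S\<close> and negates the sum.\<close>

lemma sum_chi_subspace:
  assumes S: "vec.subspace (S :: 'n::finite code)"
  shows "(\<Sum>c\<in>S. chi c x) = (if \<forall>c\<in>S. chi c x = 1 then int (card S) else 0)"
proof (cases "\<forall>c\<in>S. chi c x = 1")
  case False
  then obtain c0 where c0: "c0 \<in> S" "chi c0 x = -1" using chi_cases by blast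
  have "bij_betw ((+) c0) S S"
    by (rule bij_betwI[where g = "(+) c0"]) (use S c0 in \<open>auto simp: subspace_iff\<close>)
  then have "(\<Sum>c\<in>S. chi c x) = (\<Sum>c\<in>S. chi (c0 + c) x)"
    by (rule sum.reindex_bij_betw[symmetric])
  then have "(\<Sum>c\<in>S. chi c x) = - (\<Sum>c\<in>S. chi c x)"
    by (simp add: chi_add_left c0 sum_negf)
  then show ?thesis using False by auto
qed simp

lemma dual_code_chi: "dual_code C = {y. \<forall>x\<in>C. chi x y = 1}"
proof -
  \<comment> \<open>\<open>sgn2\<close> turns sums of bits into products of signs, and so the inner
    product into \<open>chi\<close>.\<close>
  define sgn2 :: "bit \<Rightarrow> int" where "sgn2 b = (if b = 0 then 1 else -1)" for b
  have add: "sgn2 (u + v) = sgn2 u * sgn2 v" for u v by (cases u; cases v) (simp_all add: sgn2_def)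
  have *: "sgn2 (sum f A) = (\<Prod>i\<in>A. sgn2 (f i))" if "finite A" for A :: "'a set" and f
    using that by induction (simp_all add: add sgn2_def[of 0] del: add_bit_eq_xor)
  have "sgn2 (u * v) = (if u = 1 \<and> v = 1 then -1 else 1)" for u v by (cases u; cases v) (simp_all add: sgn2_def)
  then have "sgn2 (\<Sum>i\<in>UNIV. x $ i * y $ i) = chi x y" for x y :: "bit ^ 'a"
    unfolding chi_def by (subst *) simp_all
  moreover have "b = 0 \<longleftrightarrow> sgn2 b = 1" for b by (simp add: sgn2_def)
  ultimately have "((\<Sum>i\<in>UNIV. x $ i * y $ i) = 0) = (chi x y = 1)" for x y :: "bit ^ 'a" by simp
  then show ?thesis by (simp add: dual_code_def)
qed

lemma subspace_dual: "vec.subspace (dual_code C)"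
  unfolding subspace_iff dual_code_chi by (auto simp: chi_add_right)

lemma chi_eq_1_iff: "(\<forall>u. chi u x = 1) \<longleftrightarrow> x = 0"
proof
  assume "\<forall>u. chi u x = 1"
  then have "chi x (unit i) = 1" for i by (subst chi_commute) simp
  then have "x $ i \<noteq> 1" for i by (metis chi_unit one_neq_neg_one)
  then show "x = 0" by (intro word_eqI) auto
qed simp

text \<open>Double counting of the sum of \<open>chi c y\<close> over codewords \<open>c\<close> and
  all words \<open>y\<close>: summing over \<open>c\<close> first leaves the dual words, summing
  over \<open>y\<close> first leaves \<open>c = 0\<close>.\<close>

lemma card_dual:
  assumes "vec.subspace (C :: 'n::finite code)"
  shows "card C * card (dual_code C) = 2 ^ CARD('n)"
proof -
  have "int (card C * card (dual_code C)) = (\<Sum>y\<in>dual_code C. int (card C))" by simp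
  also have "\<dots> = (\<Sum>y\<in>UNIV. if y \<in> dual_code C then int (card C) else 0)"
    by (rule sum.mono_neutral_cong_left) auto
  also have "\<dots> = (\<Sum>y\<in>UNIV. \<Sum>c\<in>C. chi c y)"
    unfolding sum_chi_subspace[OF assms] by (simp add: dual_code_chi)
  also have "\<dots> = (\<Sum>c\<in>C. \<Sum>y\<in>UNIV. chi y c)"
    by (subst sum.swap) (simp add: chi_commute)
  also have "\<dots> = (\<Sum>c\<in>C. if c = 0 then 2 ^ CARD('n) else 0)"
    by (subst sum_chi_subspace) (auto simp: chi_eq_1_iff CARD_bit subspace_iff)
  also have "\<dots> = 2 ^ CARD('n)" using assms by (simp add: subspace_iff)
  finally show ?thesis by (metis of_nat_eq_iff of_nat_numeral of_nat_power)
qed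


lemma dual_dual:
  assumes "vec.subspace (C :: 'n::finite code)"
  shows "dual_code (dual_code C) = C"
proof -
  have "C \<subseteq> dual_code (dual_code C)" by (auto simp: dual_code_chi chi_commute)
  moreover have "card C = card (dual_code (dual_code C))"
  proof -
    have "card (dual_code C) * card (dual_code (dual_code C)) = card (dual_code C) * card C"
      using card_dual[OF assms] card_dual[OF subspace_dual, of C] by (simp add: mult.commute)
    moreover have "card (dual_code C) \<noteq> 0"
      using subspace_dual[of C] by (auto simp: subspace_iff card_eq_0_iff)
    ultimately show ?thesis by simp
  qed
  ultimately show ?thesis by (metis card_subset_eq finite)
qed

section \<open>Numbers of codewords at a given distance, and Krawtchouk sums\<close>

definition dist_count :: "'n::finite code \<Rightarrow> nat \<Rightarrow> bit ^ 'n \<Rightarrow> nat" where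
  "dist_count C k x = card {e. wt e = k \<and> x + e \<in> C}"

lemma codewords_at_eq: "codewords_at C k x = dist_count C k x"
proof -
  have "bij_betw ((+) x) {c \<in> C. hamming_dist x c = k} {e. wt e = k \<and> x + e \<in> C}"
    by (rule bij_betwI[where g = "(+) x"]) (auto simp: hamming_dist_wt)
  then show ?thesis unfolding codewords_at_def dist_count_def by (rule bij_betw_same_card)
qed

text \<open>The Krawtchouk polynomial of degree \<open>k\<close> at \<open>wt u\<close>, as a
  character sum over a sphere.\<close>

definition kraw :: "nat \<Rightarrow> bit ^ 'n::finite \<Rightarrow> int" where
  "kraw k u = (\<Sum>e | wt e = k. chi u e)"

lemma sum_dual_chi:
  assumes "vec.subspace (C :: 'n::finite code)"
  shows "(\<Sum>u\<in>dual_code C. chi u x) = (if x \<in> C then int (card (dual_code C)) else 0)"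
  using dual_dual[OF assms] by (subst sum_chi_subspace[OF subspace_dual]) (auto simp: dual_code_chi)

text \<open>Fourier inversion: summed over the dual code, each \<open>chi u (x + e)\<close> becomes
  a multiple of the indicator of \<open>x + e \<in> C\<close>.\<close>

lemma sum_dual_kraw:
  assumes "vec.subspace (C :: 'n::finite code)"
  shows "(\<Sum>u\<in>dual_code C. chi u x * kraw k u) = int (card (dual_code C)) * int (dist_count C k x)"
proof -
  have "(\<Sum>u\<in>dual_code C. chi u x * kraw k u) = (\<Sum>u\<in>dual_code C. \<Sum>e | wt e = k. chi u (x + e))"
    by (simp add: kraw_def sum_distrib_left chi_add_right)
  also have "\<dots> = (\<Sum>e | wt e = k. if x + e \<in> C then int (card (dual_code C)) else 0)"
    by (subst sum.swap) (simp add: sum_dual_chi[OF assms])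
  also have "\<dots> = (\<Sum>e\<in>{e. wt e = k \<and> x + e \<in> C}. int (card (dual_code C)))"
    by (rule sum.mono_neutral_cong_right) auto
  finally show ?thesis by (simp add: dist_count_def)
qed

lemma kraw_0: "kraw 0 u = 1"
proof -
  have "{e :: bit ^ 'a. wt e = 0} = {0}" by (auto simp: wt_eq_0_iff)
  then show ?thesis by (simp add: kraw_def)
qed

lemma kraw_1: "kraw 1 u = int CARD('n) - 2 * int (wt u)" for u :: "bit ^ 'n::finite"
proof -
  have "bij_betw unit (UNIV :: 'n set) {e. wt e = 1}"
    by (rule bij_betwI') (auto simp: wt_unit axis_eq_axis One_nat_def[symmetric] simp del: One_nat_def elim: wt_eq_1)
  then have "kraw 1 u = (\<Sum>i\<in>UNIV. chi u (unit i))"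
    unfolding kraw_def by (rule sum.reindex_bij_betw[symmetric])
  then show ?thesis by (simp add: sum_chi_unit)
qed

text \<open>The product runs over pairs of a unit vector and a word of weight \<open>k\<close>.
  Their sum arises from \<open>k + 1\<close> pairs if it has weight \<open>k + 1\<close>, and from
  \<open>N - (k - 1)\<close> pairs if it has weight \<open>k - 1\<close>, where \<open>N\<close> is
  the length.\<close>

lemma kraw_rec:
  fixes u :: "bit ^ 'n::finite"
  assumes "k \<ge> 1"
  shows "kraw 1 u * kraw k u = int (k + 1) * kraw (k + 1) u + (int CARD('n) + 1 - int k) * kraw (k - 1) u"
proof -
  let ?N = "CARD('n)"
  have "kraw 1 u * kraw k u = (\<Sum>i\<in>UNIV. \<Sum>e | wt e = k. chi u (unit i + e))"
    unfolding kraw_1 sum_chi_unit[symmetric] by (simp add: kraw_def sum_product chi_add_right)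
  also have "\<dots> = (\<Sum>i\<in>UNIV. \<Sum>f\<in>UNIV. of_bool (wt (f + unit i) = k) * chi u f)"
  proof (rule sum.cong[OF refl])
    fix i :: 'n
    have b: "bij_betw ((+) (unit i)) {f. wt (f + unit i) = k} {e. wt e = k}"
      by (rule bij_betwI[where g = "(+) (unit i)"]) (auto simp: add.commute[of "unit i"])
    have "(\<Sum>e | wt e = k. chi u (unit i + e)) = (\<Sum>f | wt (f + unit i) = k. chi u (unit i + (unit i + f)))"
      by (rule sum.reindex_bij_betw[OF b, symmetric])
    also have "\<dots> = (\<Sum>f\<in>UNIV. of_bool (wt (f + unit i) = k) * chi u f)"
      by (rule sum.mono_neutral_cong_left) auto
    finally show "(\<Sum>e | wt e = k. chi u (unit i + e)) = \<dots>" .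
  qed
  also have "\<dots> = (\<Sum>f\<in>UNIV. (\<Sum>i\<in>UNIV. of_bool (wt (f + unit i) = k)) * chi u f)"
    by (subst sum.swap) (simp add: sum_distrib_right)
  also have "\<dots> = (\<Sum>f\<in>UNIV. (of_bool (wt f = k + 1) * int (k + 1) + of_bool (wt f = k - 1) * (int ?N + 1 - int k)) * chi u f)"
  proof (rule sum.cong[OF refl])
    fix f :: "bit ^ 'n"
    have "(\<Sum>i\<in>UNIV. of_bool (wt (f + unit i) = k)) = int (card {i. wt (f + unit i) = k})" by simp
    also have "{i. wt (f + unit i) = k} = (if wt f = k + 1 then supp f else if wt f + 1 = k then - supp f else {})"
      using assms wt_eq_0_iff[of f] by (auto simp: wt_add_unit split: if_splits)
    also have "int (card \<dots>) = of_bool (wt f = k + 1) * int (k + 1) + of_bool (wt f = k - 1) * (int ?N + 1 - int k)"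
      using assms wt_le[of f] by (auto simp: Compl_eq_Diff_UNIV card_Diff_subset wt_def[symmetric] of_nat_diff)
    finally show "(\<Sum>i\<in>UNIV. of_bool (wt (f + unit i) = k)) * chi u f
      = (of_bool (wt f = k + 1) * int (k + 1) + of_bool (wt f = k - 1) * (int ?N + 1 - int k)) * chi u f" by simp
  qed
  also have "\<dots> = int (k + 1) * (\<Sum>f\<in>UNIV. of_bool (wt f = k + 1) * chi u f)
      + (int ?N + 1 - int k) * (\<Sum>f\<in>UNIV. of_bool (wt f = k - 1) * chi u f)"
    unfolding sum_distrib_left sum.distrib[symmetric] by (rule sum.cong[OF refl]) (simp only: algebra_simps)
  also have "\<dots> = int (k + 1) * kraw (k + 1) u + (int ?N + 1 - int k) * kraw (k - 1) u"
  proof -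
    have "(\<Sum>f\<in>UNIV. of_bool (wt f = l) * chi u f) = kraw l u" for l
      unfolding kraw_def by (rule sum.mono_neutral_cong_right) auto
    then show ?thesis by simp
  qed
  finally show ?thesis .
qed

section \<open>Linear codes of length \<open>2\<^sup>m - 1\<close> and minimum distance at least 5\<close>

lemma sum_dist_count:
  assumes "vec.subspace (C :: 'n::finite code)"
  shows "(\<Sum>x\<in>UNIV. int (dist_count C k x)) = int (card C) * int (CARD('n) choose k)"
proof -
  have "(\<Sum>x\<in>UNIV. int (dist_count C k x)) = (\<Sum>x\<in>UNIV. \<Sum>e | wt e = k. of_bool (x + e \<in> C))"
    by (rule sum.cong) (simp_all add: dist_count_def Int_def)
  also have "\<dots> = (\<Sum>e :: bit ^ 'n | wt e = k. int (card C))"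
  proof (subst sum.swap, rule sum.cong[OF refl])
    fix e :: "bit ^ 'n"
    have "bij_betw ((+) e) {x. x + e \<in> C} C"
      by (rule bij_betwI[where g = "(+) e"]) (auto simp: add.commute[of e])
    then have "card {x. x + e \<in> C} = card C" by (rule bij_betw_same_card)
    then show "(\<Sum>x\<in>UNIV. of_bool (x + e \<in> C)) = int (card C)" by simp
  qed
  also have "\<dots> = int (card C) * int (CARD('n) choose k)" by (simp add: card_wt)
  finally show ?thesis .
qed

text \<open>The parity of \<open>m\<close> enters through \<open>q mod 3 = 2\<close>, which sharpens
  the packing bound.\<close>

locale code5 =
  fixes C :: "'n::finite code" and m :: nat and q :: int
  assumes subspace: "vec.subspace C"
    and q: "q = 2 ^ m" and odd_m: "odd m" and m_ge: "m \<ge> 3"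
    and length: "int CARD('n) = q - 1"
    and wt_ge: "\<And>c. c \<in> C \<Longrightarrow> c \<noteq> 0 \<Longrightarrow> wt c \<ge> 5"
begin

lemma q_ge: "q \<ge> 8" and q_mod3: "q mod 3 = 2"
proof -
  have "(2::int) ^ 3 \<le> 2 ^ m" using m_ge by (intro power_increasing) auto
  then show "q \<ge> 8" using q by simp
  obtain k where "m = 2 * k + 1" using odd_m by (elim oddE)
  then have "q = 4 ^ k * 2" using q by (simp add: power_mult)
  moreover have "(4::int) ^ k mod 3 = 1" by (simp flip: power_mod[of 4 3])
  ultimately show "q mod 3 = 2" by (simp add: mod_mult_left_eq[of "4 ^ k", symmetric])
qed

text \<open>The two codewords differ by \<open>e + f\<close>, of weight at least \<open>5\<close>,
  and every common support position costs \<open>2\<close> in that weight.\<close>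

lemma two_words:
  assumes "x + e \<in> C" "x + f \<in> C" "e \<noteq> f"
  shows "wt e + wt f \<ge> 5 + 2 * card (supp e \<inter> supp f)"
proof -
  have "(x + e) + (x + f) \<in> C" using assms subspace unfolding subspace_iff by blast
  moreover have "(x + e) + (x + f) = x + (x + (e + f))" by (simp only: add.assoc add.left_commute)
  ultimately have "e + f \<in> C" by (simp only: word_add_cancel)
  moreover have "e + f \<noteq> 0" using assms by (simp add: word_add_eq_0_iff)
  ultimately have "wt (e + f) \<ge> 5" by (rule wt_ge)
  then show ?thesis using wt_add[of e f] by simp
qed

lemma dist_count_0: "dist_count C 0 x = of_bool (x \<in> C)"
proof -
  have "{e. wt e = 0 \<and> x + e \<in> C} = (if x \<in> C then {0} else {})" by (auto simp: wt_eq_0_iff)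
  then show ?thesis by (simp add: dist_count_def)
qed

lemma dist_count_eq_0:
  assumes "x + e \<in> C" "wt e + k < 5" "wt e \<noteq> k"
  shows "dist_count C k x = 0"
proof -
  have False if "wt f = k" "x + f \<in> C" for f
    using two_words[OF assms(1) that(2)] assms that by auto
  then have "{f. wt f = k \<and> x + f \<in> C} = {}" by blast
  then show ?thesis by (simp add: dist_count_def)
qed

lemma dist_count_le_1:
  assumes "k \<le> 2"
  shows "dist_count C k x \<le> 1"
proof -
  have "e = f" if "wt e = k" "x + e \<in> C" "wt f = k" "x + f \<in> C" for e f
    using two_words[OF that(2,4)] that(1,3) assms by auto
  then have "card {f. wt f = k \<and> x + f \<in> C} \<le> Suc 0" by (subst card_le_Suc0_iff_eq) auto
  then show ?thesis by (simp add: dist_count_def)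
qed

lemma dist_count_pos_iff: "dist_count C k x > 0 \<longleftrightarrow> (\<exists>e. wt e = k \<and> x + e \<in> C)"
  by (auto simp: dist_count_def card_gt_0_iff)

lemma dist_count_1_pos_iff: "dist_count C 1 x > 0 \<longleftrightarrow> (\<exists>i. x + unit i \<in> C)"
  unfolding dist_count_pos_iff by (metis wt_eq_1 wt_unit)

text \<open>Two words of weight \<open>2\<close> or \<open>3\<close> in one coset have total weight
  at most \<open>6\<close>, so by \<open>two_words\<close> their supports are disjoint.\<close>

lemma packing: "2 * int (dist_count C 2 x) + 3 * int (dist_count C 3 x) \<le> q - 1"
proof -
  define E2 where "E2 = {e. wt e = 2 \<and> x + e \<in> C}"
  define E3 where "E3 = {e. wt e = 3 \<and> x + e \<in> C}"
  have disj: "supp e \<inter> supp f = {}" if "e \<in> E2 \<union> E3" "f \<in> E2 \<union> E3" "e \<noteq> f" for e f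
  proof -
    have "wt e + wt f \<le> 6" "wt e + wt f \<ge> 5 + 2 * card (supp e \<inter> supp f)"
      using that two_words[of x e f] by (auto simp: E2_def E3_def)
    then have "card (supp e \<inter> supp f) = 0" by linarith
    then show ?thesis by simp
  qed
  have "(\<Sum>e\<in>E2 \<union> E3. wt e) = card (\<Union> (supp ` (E2 \<union> E3)))"
    unfolding wt_def using disj by (subst card_UN_disjoint) auto
  also have "\<dots> \<le> CARD('n)" by (rule card_mono) auto
  also have "(\<Sum>e\<in>E2 \<union> E3. wt e) = (\<Sum>e\<in>E2. wt e) + (\<Sum>e\<in>E3. wt e)"
    by (rule sum.union_disjoint) (auto simp: E2_def E3_def)
  also have "\<dots> = 2 * card E2 + 3 * card E3" by (simp add: E2_def E3_def)
  finally have "int (2 * card E2 + 3 * card E3) \<le> int CARD('n)" by (simp only: of_nat_le_iff)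
  then show ?thesis unfolding length by (simp add: dist_count_def E2_def E3_def)
qed

text \<open>Rounding down to a multiple of \<open>3\<close>: \<open>q - 1\<close> leaves remainder
  \<open>1\<close>, and \<open>q - 3\<close>, which matters if there is a word of weight
  \<open>2\<close>, leaves remainder \<open>2\<close>.\<close>

lemma packing_mod3: "3 * (int (dist_count C 2 x) + int (dist_count C 3 x)) \<le> q - 2"
proof -
  have "dist_count C 2 x = 0 \<or> dist_count C 2 x = 1" using dist_count_le_1[of 2 x] by auto
  then show ?thesis using packing[of x] q_mod3
    by (elim disjE) (simp, presburger)+
qed

text \<open>Within distance \<open>1\<close> of the code both sides are \<open>0\<close>; elsewhere
  this is \<open>packing_mod3\<close>.\<close>

lemma packing_sphere:
  "3 * (int (dist_count C 2 x) + int (dist_count C 3 x)) \<le> (q - 2) * (1 - int (dist_count C 0 x) - int (dist_count C 1 x))"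
proof (cases "\<exists>e. wt e \<le> 1 \<and> x + e \<in> C")
  case True
  then obtain e where e: "wt e \<le> 1" "x + e \<in> C" by blast
  have "dist_count C k x = 0" if "k \<noteq> wt e" "k < 4" for k
    using dist_count_eq_0[OF e(2), of k] e(1) that by simp
  moreover have "dist_count C (wt e) x = 1"
    using dist_count_pos_iff[of "wt e" x] dist_count_le_1[of "wt e" x] e by auto
  moreover have "wt e = 0 \<or> wt e = 1" using e(1) by auto
  ultimately show ?thesis by auto
next
  case False
  then have "dist_count C 0 x = 0" "dist_count C 1 x = 0"
    using dist_count_pos_iff[of 0 x] dist_count_pos_iff[of 1 x] by auto
  then show ?thesis using packing_mod3[of x] by simp
qed

text \<open>A Johnson-type bound: for \<open>q \<equiv> 2 (mod 3)\<close> the words of weight 2 and 3 in one coset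
  cannot cover all coordinates.\<close>
lemma johnson: "int (card C) * (q * (q + 1)) \<le> 2 * 2 ^ CARD('n)"
proof -
  let ?N = "CARD('n)"
  define c where "c = int (card C)"
  have N: "int ?N = q - 1" by (rule length)
  \<comment> \<open>Summed over all words, \<open>dist_count C k\<close> gives \<open>card C\<close>
    times the size of a sphere of radius \<open>k\<close>.\<close>
  have "3 * (c * int (?N choose 2) + c * int (?N choose 3))
      = (\<Sum>x\<in>UNIV. 3 * (int (dist_count C 2 x) + int (dist_count C 3 x)))"
    by (simp add: sum.distrib sum_distrib_left[symmetric] sum_dist_count[OF subspace] c_def)
  also have "\<dots> \<le> (\<Sum>x\<in>UNIV. (q - 2) * (1 - int (dist_count C 0 x) - int (dist_count C 1 x)))"
    by (rule sum_mono) (rule packing_sphere)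
  also have "\<dots> = (q - 2) * (2 ^ ?N - c * int (?N choose 0) - c * int (?N choose 1))"
    by (simp only: sum_distrib_left[symmetric] sum_subtractf sum_dist_count[OF subspace] c_def)
      (simp add: CARD_bit)
  also have "\<dots> = (q - 2) * (2 ^ ?N - c * q)" 
  proof -
    have "q = int ?N + 1" using N by simp
    then show ?thesis by (simp add: algebra_simps)
  qed
  finally have 1: "3 * c * (int (?N choose 2) + int (?N choose 3)) \<le> (q - 2) * (2 ^ ?N - c * q)"
    by (simp add: algebra_simps)
  have "(?N choose 2) + (?N choose 3) = (?N + 1) choose 3" by (simp add: numeral_3_eq_3 numeral_2_eq_2)
  moreover have "6 * ((?N + 1) choose 3) = (?N + 1) * ?N * (?N - 1)"
  proof -
    have a: "3 * ((?N + 1) choose 3) = (?N + 1) * (?N choose 2)"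
      using Suc_times_binomial_eq[of ?N 2] by (simp add: numeral_3_eq_3 mult.commute)
    have b: "2 * (?N choose 2) = ?N * (?N - 1)" by (simp add: choose_two)
    have "6 * ((?N + 1) choose 3) = 2 * (3 * ((?N + 1) choose 3))" by simp
    also have "\<dots> = (?N + 1) * (2 * (?N choose 2))" unfolding a by simp
    finally show ?thesis unfolding b by (simp add: algebra_simps)
  qed
  ultimately have "int (6 * ((?N choose 2) + (?N choose 3))) = int ((?N + 1) * ?N * (?N - 1))" by simp
  then have "6 * (int (?N choose 2) + int (?N choose 3)) = q * (q - 1) * (q - 2)"
    using N q_ge by (simp add: of_nat_diff algebra_simps)
  then have "(q - 2) * (c * (q * (q - 1))) = c * (6 * (int (?N choose 2) + int (?N choose 3)))"
    by (simp only: mult_ac)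
  also have "\<dots> = 2 * (3 * c * (int (?N choose 2) + int (?N choose 3)))" by simp
  also have "\<dots> \<le> 2 * ((q - 2) * (2 ^ ?N - c * q))" using 1 by linarith
  also have "\<dots> = (q - 2) * (2 * (2 ^ ?N - c * q))" by (simp only: mult_ac)
  finally have "c * (q * (q - 1)) \<le> 2 * (2 ^ ?N - c * q)" using q_ge by simp
  then show ?thesis by (simp add: c_def algebra_simps)
qed

text \<open>The strict inequality \<open>q^2 < q * (q + 1)\<close> absorbs the factor
  \<open>2\<close> of \<open>johnson\<close> when powers of two are compared.\<close>

lemma card_le:
  assumes "card C = 2 ^ k"
  shows "k + 2 * m \<le> CARD('n)"
proof -
  have "(2::int) ^ (k + 2 * m) < 2 ^ k * (q * (q + 1))"
    using q_ge by (simp add: q power_add mult_2)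
  also have "\<dots> \<le> 2 ^ (CARD('n) + 1)" using johnson assms by simp
  finally have "k + 2 * m < CARD('n) + 1" by (rule power_less_imp_less_exp[rotated]) simp
  then show ?thesis by simp
qed

end

section \<open>Power moments of the dual code\<close>

lemma min_dist_subspace:
  assumes "vec.subspace (D :: 'n::finite code)"
  shows "min_dist D = Min (wt ` (D - {0}))"
proof -
  have "{hamming_dist x y | x y. x \<in> D \<and> y \<in> D \<and> x \<noteq> y} = wt ` (D - {0})" (is "?A = ?B")
  proof
    show "?A \<subseteq> ?B"
      using assms unfolding hamming_dist_wt subspace_iff
      by (auto intro!: imageI simp: word_add_eq_0_iff)
    show "?B \<subseteq> ?A"
    proof
      fix w assume "w \<in> ?B"
      then obtain c where "c \<in> D" "c \<noteq> 0" "w = hamming_dist c 0" by (auto simp: hamming_dist_wt)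
      then show "w \<in> ?A" using assms unfolding subspace_iff by blast
    qed
  qed
  then show ?thesis by (simp add: min_dist_def)
qed

text \<open>Each edge adds a word of minimum weight that contains \<open>i\<close>. The hypothesis
  \<open>span\<close> says in dual form that these words span \<open>D\<close>.\<close>

lemma i_graph_connected:
  fixes D :: "'n::finite code"
  assumes D: "vec.subspace D"
    and span: "\<And>v. (\<And>u. u \<in> D \<Longrightarrow> wt u = min_dist D \<Longrightarrow> u $ i = 1 \<Longrightarrow> chi u v = 1) \<Longrightarrow> v \<in> dual_code D"
  shows "i_component i D D \<and> Digraph_Component.connected (with_proj (i_graph i D))"
proof -
  let ?G = "with_proj (i_graph i D)"
  let ?E = "parcs (i_graph i D)"
  have verts: "pverts (i_graph i D) = D" by (simp add: i_graph_def)
  \<comment> \<open>The words by which every vertex can be translated along a walk. Concatenation of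
    walks makes \<open>S\<close> a subspace, it contains the generators, and double duality then
    gives all of \<open>D\<close>.\<close>
  define S where "S = {s \<in> D. \<forall>x\<in>D. (x, x + s) \<in> rtrancl_on D ?E}"
  have S: "vec.subspace S"
    unfolding subspace_iff
  proof (intro conjI ballI)
    show "0 \<in> S" using D by (auto simp: S_def subspace_iff)
    fix s t assume st: "s \<in> S" "t \<in> S"
    then have D': "s \<in> D" "t \<in> D" by (auto simp: S_def)
    have "(x, x + (s + t)) \<in> rtrancl_on D ?E" if "x \<in> D" for x
    proof -
      have "x + s \<in> D" using that D' D by (simp add: subspace_iff)
      then have "(x + s, (x + s) + t) \<in> rtrancl_on D ?E" using st by (simp add: S_def)
      moreover have "(x, x + s) \<in> rtrancl_on D ?E" using st that by (simp add: S_def)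
      ultimately show ?thesis unfolding add.assoc by (metis rtrancl_on_trans)
    qed
    then show "s + t \<in> S" using D' D by (simp add: S_def subspace_iff)
  qed
  have A: "u \<in> S" if u: "u \<in> D" "wt u = min_dist D" "u $ i = 1" for u
  proof -
    have "(x, x + u) \<in> rtrancl_on D ?E" if x: "x \<in> D" for x
    proof -
      have xu: "x + u \<in> D" using x u D by (simp add: subspace_iff)
      have "(x + u) $ i \<noteq> x $ i" using word_add_eq_1[of x u i] u by metis
      then have "(x, x + u) \<in> ?E" using x xu u by (auto simp: i_graph_def hamming_dist_wt)
      then show ?thesis using x xu by (meson rtrancl_on_into_rtrancl_on rtrancl_on_refl)
    qed
    then show ?thesis using u by (simp add: S_def)
  qed
  have "dual_code S \<subseteq> dual_code D"
    using span A by (auto simp: dual_code_chi)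
  then have "dual_code (dual_code D) \<subseteq> dual_code (dual_code S)"
    unfolding dual_code_chi[of "dual_code _"] by blast
  then have DS: "D \<subseteq> S" by (simp add: dual_dual D S)
  have reach: "(x, y) \<in> rtrancl_on D ?E" if "x \<in> D" "y \<in> D" for x y
  proof -
    have "x + y \<in> S" using that DS D by (auto simp: subspace_iff)
    then have "(x, x + (x + y)) \<in> rtrancl_on D ?E" using that by (simp only: S_def) blast
    then show ?thesis by simp
  qed
  have D0: "D \<noteq> {}" using D by (auto simp: subspace_iff)
  \<comment> \<open>Walks never leave \<open>D\<close>, so no word outside can belong to the same
    component.\<close>
  have "v \<in> D" if "(u, v) \<in> rtrancl_on D ?E" for u v
    using that by (rule in_rtrancl_on_in_F(2))
  then have "D \<in> {S. S \<noteq> {} \<and> (\<forall>u\<in>S. \<forall>v\<in>S. (u, v) \<in> rtrancl_on D ?E) \<and>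
      (\<forall>u\<in>S. \<forall>v. v \<notin> S \<longrightarrow> (u, v) \<notin> rtrancl_on D ?E \<or> (v, u) \<notin> rtrancl_on D ?E)}"
    using D0 reach by (intro CollectI conjI ballI allI impI disjI1 notI) blast+
  then have "i_component i D D"
    by (simp only: i_component_def pre_digraph.sccs_verts_def reachable_def with_proj_simps verts)
  moreover have "Digraph_Component.connected ?G"
  proof -
    have "(y, x) \<in> ?E" if "(x, y) \<in> ?E" for x y
      using that unfolding i_graph_def hamming_dist_wt by (simp add: add.commute[of x y]) metis
    then have "parcs (mk_symmetric ?G) = ?E"
      unfolding mk_symmetric_def by auto
    moreover have "pverts (mk_symmetric ?G) = D"
      by (simp only: mk_symmetric_def pair_pre_digraph.simps with_proj_simps verts)
    ultimately show ?thesis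
      unfolding connected_def strongly_connected_def reachable_def
      by (simp only: with_proj_simps) (use D0 reach in blast)
  qed
  ultimately show ?thesis by blast
qed

locale code5_dual = code5 C m q for C :: "'n::finite code" and m q +
  assumes card_dual_eq: "int (card (dual_code C)) = q\<^sup>2"
begin

text \<open>The character sum of \<open>u\<close> extended by a zero coordinate to length
  \<open>q\<close>, hence one more than \<open>kraw 1 u\<close>. The shift makes all values even and
  gives \<open>q\<close> at the zero word.\<close>

definition Y :: "bit ^ 'n \<Rightarrow> int" where
  "Y u = q - 2 * int (wt u)"

abbreviation "d k x \<equiv> int (dist_count C k x)"

text \<open>\<open>F\<close> is the Fourier transform over the dual code of \<open>f\<close>
  composed with \<open>Y\<close>, divided by the number \<open>q^2\<close> of dual words.\<close>

definition has_transform :: "(int \<Rightarrow> int) \<Rightarrow> (bit ^ 'n \<Rightarrow> int) \<Rightarrow> bool" where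
  "has_transform f F \<longleftrightarrow> (\<forall>x. (\<Sum>u\<in>dual_code C. chi u x * f (Y u)) = q\<^sup>2 * F x)"

lemma has_transform_lincomb:
  assumes "\<And>u. f (Y u) = (\<Sum>k\<le>n. c k * kraw k u)"
  shows "has_transform f (\<lambda>x. \<Sum>k\<le>n. c k * d k x)"
  unfolding has_transform_def
proof
  fix x
  have "(\<Sum>u\<in>dual_code C. chi u x * f (Y u)) = (\<Sum>k\<le>n. c k * (\<Sum>u\<in>dual_code C. chi u x * kraw k u))"
    unfolding assms sum_distrib_left by (subst sum.swap) (simp add: mult_ac)
  also have "\<dots> = q\<^sup>2 * (\<Sum>k\<le>n. c k * d k x)"
    by (simp add: sum_dual_kraw[OF subspace] card_dual_eq sum_distrib_left mult_ac)
  finally show "(\<Sum>u\<in>dual_code C. chi u x * f (Y u)) = q\<^sup>2 * (\<Sum>k\<le>n. c k * d k x)" .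
qed

lemma kraw_rels:
  shows "Y u = kraw 1 u + 1"
    and "kraw 1 u * kraw 1 u = 2 * kraw 2 u + (q - 1)"
    and "kraw 1 u * kraw 2 u = 3 * kraw 3 u + (q - 2) * kraw 1 u"
    and "kraw 1 u * kraw 3 u = 4 * kraw 4 u + (q - 3) * kraw 2 u"
proof -
  show "Y u = kraw 1 u + 1" by (simp add: Y_def kraw_1 length del: One_nat_def)
  show "kraw 1 u * kraw 1 u = 2 * kraw 2 u + (q - 1)"
    using kraw_rec[of 1 u] by (simp add: kraw_0 length numeral_2_eq_2)
  show "kraw 1 u * kraw 2 u = 3 * kraw 3 u + (q - 2) * kraw 1 u"
    using kraw_rec[of 2 u] by (simp add: length numeral_2_eq_2 numeral_3_eq_3)
  show "kraw 1 u * kraw 3 u = 4 * kraw 4 u + (q - 3) * kraw 2 u"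
    using kraw_rec[of 3 u] by (simp add: length numeral_2_eq_2 numeral_3_eq_3 numeral_eq_Suc)
qed

text \<open>The three-term recurrence expands the powers of \<open>Y\<close> in the
  \<open>kraw k\<close>, each of which transforms into \<open>d k\<close>; \<open>c k\<close>
  collects the coefficients of \<open>kraw k\<close>.\<close>

lemma quartic_transform:
  "has_transform (\<lambda>y. c0 + c1 * y + c2 * y\<^sup>2 + c3 * y^3 + c4 * y^4)
    (\<lambda>x. c0 * d 0 x + c1 * (d 0 x + d 1 x) + c2 * (2 * d 2 x + 2 * d 1 x + q * d 0 x)
      + c3 * (6 * (d 3 x + d 2 x) + (3 * q - 2) * (d 1 x + d 0 x))
      + c4 * (24 * (d 4 x + d 3 x) + (12 * q - 16) * (d 2 x + d 1 x) + (3 * q\<^sup>2 - 2 * q) * d 0 x))"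
proof -
  define c where "c k = (if k = 0 then c0 + c1 + c2 * q + c3 * (3 * q - 2) + c4 * (3 * q\<^sup>2 - 2 * q)
    else if k = 1 then c1 + 2 * c2 + c3 * (3 * q - 2) + c4 * (12 * q - 16)
    else if k = 2 then 2 * c2 + 6 * c3 + c4 * (12 * q - 16)
    else if k = 3 then 6 * c3 + 24 * c4 else 24 * c4)" for k :: nat
  have sum4: "(\<Sum>k\<le>4. c k * g k) = c 0 * g 0 + c 1 * g 1 + c 2 * g 2 + c 3 * g 3 + c 4 * g 4" for g :: "nat \<Rightarrow> int"
    by (simp add: numeral_eq_Suc)
  have "has_transform (\<lambda>y. c0 + c1 * y + c2 * y\<^sup>2 + c3 * y^3 + c4 * y^4) (\<lambda>x. \<Sum>k\<le>4. c k * d k x)"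
  proof (rule has_transform_lincomb)
    fix u :: "bit ^ 'n"
    define X where "X = kraw 1 u"
    note rels = kraw_rels[of u, folded X_def]
    have y2: "(Y u)\<^sup>2 = 2 * kraw 2 u + 2 * X + q"
      using rels by (simp add: power2_eq_square algebra_simps)
    have "X * (Y u)\<^sup>2 = 2 * (X * kraw 2 u) + 2 * (X * X) + q * X" unfolding y2 by (simp add: algebra_simps)
    then have y3: "(Y u)^3 = 6 * kraw 3 u + 6 * kraw 2 u + (3 * q - 2) * X + (3 * q - 2)"
      unfolding rels(2,3) using y2 by (simp add: rels(1) power3_eq_cube power2_eq_square algebra_simps)
    have "X * (Y u)^3 = 6 * (X * kraw 3 u) + 6 * (X * kraw 2 u) + (3 * q - 2) * (X * X) + (3 * q - 2) * X"
      unfolding y3 by (simp add: algebra_simps)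
    moreover have "(Y u)^4 = X * (Y u)^3 + (Y u)^3" using rels(1) by (simp add: numeral_eq_Suc algebra_simps)
    ultimately have y4: "(Y u)^4 = 24 * kraw 4 u + 24 * kraw 3 u + (12 * q - 16) * kraw 2 u + (12 * q - 16) * X + (3 * q\<^sup>2 - 2 * q)"
      unfolding rels(2-4) y3 by (simp add: power2_eq_square algebra_simps)
    show "c0 + c1 * Y u + c2 * (Y u)\<^sup>2 + c3 * (Y u)^3 + c4 * (Y u)^4 = (\<Sum>k\<le>4. c k * kraw k u)"
      unfolding sum4 y2 y3 y4 X_def by (simp add: c_def kraw_0 kraw_rels(1) algebra_simps)
  qed
  moreover have "(\<Sum>k\<le>4. c k * d k x) = c0 * d 0 x + c1 * (d 0 x + d 1 x) + c2 * (2 * d 2 x + 2 * d 1 x + q * d 0 x)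
      + c3 * (6 * (d 3 x + d 2 x) + (3 * q - 2) * (d 1 x + d 0 x))
      + c4 * (24 * (d 4 x + d 3 x) + (12 * q - 16) * (d 2 x + d 1 x) + (3 * q\<^sup>2 - 2 * q) * d 0 x)" for x
    unfolding sum4 by (simp add: c_def algebra_simps)
  ultimately show ?thesis by simp
qed

end

section \<open>Minimum weight words of the dual code\<close>

lemma card_4_sorted:
  fixes A :: "'a::linorder set"
  assumes "card A = 4"
  obtains a b c d where "a < b" "b < c" "c < d" "A = {a, b, c, d}"
proof -
  have fin: "finite A" using assms card.infinite by fastforce
  define xs where "xs = sorted_list_of_set A"
  have xs: "length xs = 4" "sorted_wrt (<) xs" "set xs = A"
    using fin assms by (simp_all add: xs_def)
  then obtain a b c d where "xs = [a, b, c, d]"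
    by (auto simp: numeral_eq_Suc length_Suc_conv)
  then show ?thesis using xs that[of a b c d] by auto
qed

context code5_dual
begin

abbreviation "D \<equiv> dual_code C"
abbreviation "Vals \<equiv> Y ` (D - {0})"

lemma four_dvd_q: "4 dvd q"
  using m_ge le_imp_power_dvd[of 2 m "2::int"] q by simp

lemma zero_in: "0 \<in> C" "0 \<in> D"
  using subspace subspace_dual[of C] by (simp_all add: subspace_iff)

lemma Y_0: "Y 0 = q" by (simp add: Y_def)

lemma Y_bounds: assumes "u \<noteq> 0" shows "\<bar>Y u\<bar> \<le> q - 2"
proof -
  have "wt u \<ge> 1" using assms wt_eq_0_iff[of u] by auto
  moreover have "int (wt u) \<le> q - 1" using wt_le[of u] length by linarith
  ultimately show ?thesis by (simp add: Y_def)
qed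

lemma even_Y: "even (Y u)"
  using four_dvd_q by (auto simp: Y_def intro: dvd_trans[of 2 4])

lemma d_code:
  assumes "x \<in> C" shows "d 0 x = 1" "d (Suc 0) x = 0" "d 2 x = 0" "d 3 x = 0" "d 4 x = 0"
  using assms dist_count_eq_0[of x 0] by (simp_all add: dist_count_0)

lemma d_unit:
  assumes "x + unit i \<in> C" shows "d 0 x = 0" "d (Suc 0) x = 1" "d 2 x = 0" "d 3 x = 0"
proof -
  show "d 0 x = 0" "d 2 x = 0" "d 3 x = 0"
    using dist_count_eq_0[OF assms] by (simp_all add: wt_unit)
  have "dist_count C 1 x > 0" using assms by (auto simp: dist_count_1_pos_iff simp del: One_nat_def)
  then show "d (Suc 0) x = 1" using dist_count_le_1[of 1 x] by simp
qed

text \<open>At the word \<open>0\<close> the counts \<open>d 1\<close> to \<open>d 4\<close> vanish,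
  so the transform there gives the sum over all of \<open>D\<close>; the zero word accounts for the
  value of the polynomial at \<open>q\<close>.\<close>

lemma sum_nonzero:
  "(\<Sum>u\<in>D - {0}. c0 + c1 * Y u + c2 * (Y u)\<^sup>2 + c3 * (Y u)^3 + c4 * (Y u)^4)
    = (q - 1) * (c0 * (q + 1) + c1 * q + c2 * q\<^sup>2 + 2 * c3 * q\<^sup>2 + 2 * c4 * q^3)"
proof -
  define f where "f y = c0 + c1 * y + c2 * y\<^sup>2 + c3 * y^3 + c4 * y^4" for y :: int
  have "(\<Sum>u\<in>D. chi u 0 * f (Y u)) = q\<^sup>2 * (c0 + c1 + c2 * q + c3 * (3 * q - 2) + c4 * (3 * q\<^sup>2 - 2 * q))"
    using quartic_transform[of c0 c1 c2 c3 c4, unfolded has_transform_def, rule_format, of 0] d_code[OF zero_in(1)]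
    unfolding f_def by simp
  moreover have "(\<Sum>u\<in>D. chi u 0 * f (Y u)) = f q + (\<Sum>u\<in>D - {0}. f (Y u))"
    using zero_in(2) by (simp add: sum.remove[of _ 0] Y_0)
  ultimately have "(\<Sum>u\<in>D - {0}. f (Y u)) = q\<^sup>2 * (c0 + c1 + c2 * q + c3 * (3 * q - 2) + c4 * (3 * q\<^sup>2 - 2 * q)) - f q"
    by simp
  also have "\<dots> = (q - 1) * (c0 * (q + 1) + c1 * q + c2 * q\<^sup>2 + 2 * c3 * q\<^sup>2 + 2 * c4 * q^3)"
    by (simp add: f_def algebra_simps power2_eq_square power3_eq_cube numeral_eq_Suc)
  finally show ?thesis by (simp add: f_def)
qed

lemma second_difference:
  assumes f: "has_transform f F"
    and v: "\<And>u. u \<in> D - {0} \<Longrightarrow> f (Y u) \<noteq> 0 \<Longrightarrow> u $ i = 1 \<Longrightarrow> chi u v = 1"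
  shows "F 0 - F (unit i) - F v + F (v + unit i) = 0"
proof -
  have T: "(\<Sum>u\<in>D. chi u x * f (Y u)) = q\<^sup>2 * F x" for x
    using f unfolding has_transform_def by blast
  \<comment> \<open>The first factor vanishes unless \<open>u $ i = 1\<close>, and in that case
    hypothesis \<open>v\<close> makes one of the other two vanish.\<close>
  have "(\<Sum>u\<in>D. (1 - chi u (unit i)) * (1 - chi u v) * f (Y u)) = 0"
  proof (rule sum.neutral, rule ballI)
    fix u assume "u \<in> D"
    then show "(1 - chi u (unit i)) * (1 - chi u v) * f (Y u) = 0"
      using v[of u] by (cases "u = 0") (auto simp: chi_unit)
  qed
  moreover have "(\<Sum>u\<in>D. (1 - chi u (unit i)) * (1 - chi u v) * f (Y u))
      = (\<Sum>u\<in>D. chi u 0 * f (Y u)) - (\<Sum>u\<in>D. chi u (unit i) * f (Y u)) - (\<Sum>u\<in>D. chi u v * f (Y u))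
        + (\<Sum>u\<in>D. chi u (v + unit i) * f (Y u))"
    by (simp add: chi_add_right algebra_simps sum.distrib sum_subtractf)
  ultimately have "q\<^sup>2 * F 0 - q\<^sup>2 * F (unit i) - q\<^sup>2 * F v + q\<^sup>2 * F (v + unit i) = 0"
    unfolding T by linarith
  then have "q\<^sup>2 * (F 0 - F (unit i) - F v + F (v + unit i)) = 0" by (simp add: algebra_simps)
  then show ?thesis using q_ge by simp
qed

lemma sum_Y_pos: "\<exists>u\<in>D - {0}. Y u > 0"
proof (rule ccontr)
  assume "\<not> ?thesis"
  then have "(\<Sum>u\<in>D - {0}. Y u) \<le> 0" by (intro sum_nonpos) (meson not_less)
  moreover have "(\<Sum>u\<in>D - {0}. Y u) = (q - 1) * q" using sum_nonzero[of 0 1 0 0 0] by simp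
  ultimately show False using q_ge by (simp add: mult_le_0_iff)
qed

lemma coset_shift:
  assumes "v + unit j \<in> C" "v + unit i \<notin> C"
  shows "d 2 (v + unit i) = 1"
proof -
  have "i \<noteq> j" using assms by auto
  then have "wt (unit i + unit j :: bit ^ 'n) = 2" by (simp add: wt_add_unit supp_unit wt_unit)
  moreover have "(v + unit i) + (unit i + unit j) \<in> C"
    using assms(1) by (simp add: add.assoc)
  ultimately have "dist_count C 2 (v + unit i) > 0" by (auto simp: dist_count_pos_iff)
  then show ?thesis using dist_count_le_1[of 2 "v + unit i"] by simp
qed

lemma not_code_cases:
  assumes "v \<notin> C"
  obtains j where "v + unit j \<in> C" "d 0 v = 0" "d (Suc 0) v = 1" "d 2 v = 0" "d 3 v = 0"
  | "d 0 v = 0" "d (Suc 0) v = 0" "d 2 v = 0 \<or> d 2 v = 1" "3 * (d 2 v + d 3 v) \<le> q - 2" "\<And>j. v + unit j \<notin> C"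
proof (cases "\<exists>j. v + unit j \<in> C")
  case True
  then show ?thesis using that(1) d_unit by blast
next
  case False
  then have "d (Suc 0) v = 0" using dist_count_1_pos_iff[of v] by simp
  moreover have "d 0 v = 0" using assms by (simp add: dist_count_0)
  moreover have "d 2 v = 0 \<or> d 2 v = 1" using dist_count_le_1[of 2 v] by auto
  ultimately show ?thesis using that(2) packing_mod3 False by blast
qed

text \<open>Let \<open>p\<close> be the cubic with the values as roots, repeated if there are fewer
  than three. Both \<open>p (Y w)\<close> and \<open>Y w * p (Y w)\<close> sum to \<open>0\<close>,
  and the power moments then force \<open>p\<close> to be \<open>y^3 - 2 * q * y\<close>.\<close>

lemma few_values_rigid:
  assumes "card Vals \<le> 3" "u \<in> D - {0}"
  shows "(Y u)^3 = 2 * q * Y u"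
proof -
  have "card Vals \<noteq> 0" using assms(2) by auto
  then have "card Vals = 1 \<or> card Vals = 2 \<or> card Vals = 3" using assms(1) by linarith
  then obtain y1 y2 y3 where y: "Vals = {y1, y2, y3}"
  proof (elim disjE)
    assume "card Vals = 1"
    then obtain y where "Vals = {y}" by (rule card_1_singletonE)
    then show ?thesis using that[of y y y] by simp
  next
    assume "card Vals = 2"
    then obtain y z where "Vals = {y, z}" by (auto simp: card_2_iff)
    then show ?thesis using that[of y z z] by simp
  next
    assume "card Vals = 3"
    then show ?thesis using that by (auto simp: card_3_iff)
  qed
  define e1 where "e1 = y1 + y2 + y3"
  define e2 where "e2 = y1 * y2 + y1 * y3 + y2 * y3"
  define e3 where "e3 = y1 * y2 * y3"
  have root: "(Y w)^3 - e1 * (Y w)\<^sup>2 + e2 * Y w - e3 = 0" if "w \<in> D - {0}" for w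
  proof -
    have "Y w = y1 \<or> Y w = y2 \<or> Y w = y3" using that y by blast
    then have "(Y w - y1) * (Y w - y2) * (Y w - y3) = 0" by auto
    then show ?thesis by (simp add: e1_def e2_def e3_def algebra_simps power2_eq_square power3_eq_cube)
  qed
  have "(\<Sum>w\<in>D - {0}. (-e3) + e2 * Y w + (-e1) * (Y w)\<^sup>2 + 1 * (Y w)^3 + 0 * (Y w)^4) = 0"
  proof (intro sum.neutral ballI)
    fix w assume "w \<in> D - {0}"
    then show "(-e3) + e2 * Y w + (-e1) * (Y w)\<^sup>2 + 1 * (Y w)^3 + 0 * (Y w)^4 = 0"
      using root[of w] by simp
  qed
  then have "(q - 1) * (2 * q\<^sup>2 - e1 * q\<^sup>2 + e2 * q - e3 * (q + 1)) = 0"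
    unfolding sum_nonzero by (simp add: algebra_simps)
  then have E0: "2 * q\<^sup>2 - e1 * q\<^sup>2 + e2 * q - e3 * (q + 1) = 0" using q_ge by simp
  have "(\<Sum>w\<in>D - {0}. 0 + (-e3) * Y w + e2 * (Y w)\<^sup>2 + (-e1) * (Y w)^3 + 1 * (Y w)^4) = 0"
  proof (intro sum.neutral ballI)
    fix w assume "w \<in> D - {0}"
    then have "Y w * ((Y w)^3 - e1 * (Y w)\<^sup>2 + e2 * Y w - e3) = 0" using root by simp
    then show "0 + (-e3) * Y w + e2 * (Y w)\<^sup>2 + (-e1) * (Y w)^3 + 1 * (Y w)^4 = 0"
      by (simp add: algebra_simps power2_eq_square power3_eq_cube numeral_eq_Suc)
  qed
  then have "(q - 1) * (2 * q^3 - 2 * e1 * q\<^sup>2 + e2 * q\<^sup>2 - e3 * q) = 0"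
    unfolding sum_nonzero by (simp add: algebra_simps)
  then have E1: "2 * q^3 - 2 * e1 * q\<^sup>2 + e2 * q\<^sup>2 - e3 * q = 0" using q_ge by simp
  have "y \<in> Vals \<Longrightarrow> even y \<and> \<bar>y\<bar> \<le> q - 2" for y using even_Y Y_bounds by auto
  then have "even y1" "even y2" "even y3" "\<bar>y1\<bar> \<le> q - 2" "\<bar>y2\<bar> \<le> q - 2" "\<bar>y3\<bar> \<le> q - 2"
    unfolding y by auto
  from three_values_rigid[OF q m_ge this e1_def e2_def e3_def E0 E1]
  show ?thesis using root[OF assms(2)] by simp
qed

lemma spanning_few:
  assumes few: "card Vals \<le> 3"
    and v: "\<And>u. u \<in> D - {0} \<Longrightarrow> Y u = Max Vals \<Longrightarrow> u $ i = 1 \<Longrightarrow> chi u v = 1"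
  shows "v \<in> C"
proof (rule ccontr)
  assume "v \<notin> C"
  obtain u0 where u0: "u0 \<in> D - {0}" "Y u0 > 0" using sum_Y_pos by blast
  define s where "s = Y u0"
  have root: "y * (y\<^sup>2 - 2 * q) = 0" if "y \<in> Vals" for y
    using that few_values_rigid[OF few] by (auto simp: algebra_simps power2_eq_square power3_eq_cube)
  have s: "s > 0" "s\<^sup>2 = 2 * q" using u0 root[of s] by (auto simp: s_def)
  have vals: "y = 0 \<or> y = s \<or> y = - s" if "y \<in> Vals" for y
    using root[OF that] s(2) power2_eq_iff[of y s] by auto
  have max: "Max Vals = s"
  proof (rule Max_eqI)
    show "y \<le> s" if "y \<in> Vals" for y using vals[OF that] s(1) by auto
  qed (use u0 in \<open>auto simp: s_def\<close>)
  \<comment> \<open>The polynomial \<open>y * (y + s)\<close> vanishes at \<open>0\<close> and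
    \<open>-s\<close>, so only nonzero words with the largest value \<open>s\<close>
    survive.\<close>
  have "has_transform (\<lambda>y. s * y + y\<^sup>2) (\<lambda>x. s * (d 0 x + d (Suc 0) x) + (2 * d 2 x + 2 * d (Suc 0) x + q * d 0 x))"
    using quartic_transform[of 0 s 1 0 0] by simp
  moreover have "chi u v = 1" if "u \<in> D - {0}" "s * Y u + (Y u)\<^sup>2 \<noteq> 0" "u $ i = 1" for u
  proof (rule v[OF that(1) _ that(3)])
    show "Y u = Max Vals" using vals[of "Y u"] that(1,2) max by (auto simp: power2_eq_square)
  qed
  ultimately have eq: "(s + q) - (s + 2) - (s * (d 0 v + d (Suc 0) v) + (2 * d 2 v + 2 * d (Suc 0) v + q * d 0 v))
      + (s * (d 0 (v + unit i) + d (Suc 0) (v + unit i)) + (2 * d 2 (v + unit i) + 2 * d (Suc 0) (v + unit i) + q * d 0 (v + unit i))) = 0"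
    using second_difference[of _ _ i v] d_code[OF zero_in(1)] d_unit[of "unit i" i] zero_in(1) by fastforce
  \<comment> \<open>The relation \<open>eq\<close> says that \<open>q - 2\<close> is the drop from
    \<open>v\<close> to \<open>v + unit i\<close>. If \<open>v\<close> has distance \<open>1\<close>
    from \<open>C\<close> and \<open>v + unit i\<close> is not a codeword, this drop is at most
    \<open>s\<close> by \<open>coset_shift\<close>.\<close>
  have "s < q - 2"
  proof (rule ccontr)
    assume "\<not> s < q - 2"
    then have "(q - 2)\<^sup>2 \<le> s\<^sup>2" using q_ge by (intro power_mono) auto
    moreover have "8 * q \<le> q * q" using q_ge by simp
    ultimately show False using q_ge unfolding s(2) by (simp add: algebra_simps power2_eq_square)
  qed
  have nonneg: "s * (d 0 (v + unit i) + d (Suc 0) (v + unit i)) \<ge> 0" "q * d 0 (v + unit i) \<ge> 0" using s q_ge by auto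
  show False
  proof (cases "v + unit i \<in> C")
    case True
    then show False using eq d_code[OF True] d_unit[OF True] q_ge by simp
  next
    case False
    from \<open>v \<notin> C\<close> show False
    proof (cases rule: not_code_cases)
      case (1 j)
      then show False using eq coset_shift[OF 1(1) False] nonneg \<open>s < q - 2\<close> by simp
    next
      case 2
      then show False using eq nonneg q_ge by auto
    qed
  qed
qed

section \<open>Four values: divisibility by powers of two\<close>

definition ones :: "bit ^ 'n" where "ones = (\<chi> i. 1)"

lemma chi_ones: "chi u ones = (-1) ^ wt u"
proof -
  have "chi u ones = (\<Prod>i\<in>UNIV. if i \<in> supp u then -1 else 1)"
    unfolding chi_def ones_def by (rule prod.cong) (auto simp: supp_def)
  also have "\<dots> = (-1) ^ wt u" by (simp add: prod.If_cases wt_def)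
  finally show ?thesis .
qed

lemma odd_wt_iff: "odd (wt u) \<longleftrightarrow> \<not> 4 dvd Y u"
proof -
  obtain r where "q = 4 * r" using four_dvd_q by (elim dvdE)
  then show ?thesis unfolding Y_def by presburger
qed

text \<open>If \<open>Y u\<close> were the only such value,
  \<open>(1 - chi w ones) * (Y w - Y u)\<close> would vanish on \<open>D\<close>, since its first
  factor kills even weights. The transform of \<open>y - Y u\<close> would then agree at
  \<open>0\<close> and at \<open>ones\<close>, a word outside \<open>C\<close>, which leaves only
  \<open>0\<close> and \<open>1\<close> for \<open>Y u\<close>.\<close>

lemma two_values_not_dvd4:
  assumes "u \<in> D" "\<not> 4 dvd Y u"
  shows "\<exists>w\<in>D. \<not> 4 dvd Y w \<and> Y w \<noteq> Y u"
proof (rule ccontr)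
  assume "\<not> ?thesis"
  then have only: "Y w = Y u" if "w \<in> D" "odd (wt w)" for w using that odd_wt_iff by blast
  have T: "(\<Sum>w\<in>D. chi w x * ((- Y u) + Y w)) = q\<^sup>2 * (- Y u * d 0 x + (d 0 x + d (Suc 0) x))" for x
    using quartic_transform[of "- Y u" 1 0 0 0, unfolded has_transform_def, rule_format, of x] by simp
  have "(\<Sum>w\<in>D. (1 - chi w ones) * ((- Y u) + Y w)) = 0"
  proof (rule sum.neutral, rule ballI)
    fix w assume "w \<in> D"
    then show "(1 - chi w ones) * ((- Y u) + Y w) = 0" using only[of w] by (cases "odd (wt w)") (auto simp: chi_ones)
  qed
  moreover have "(\<Sum>w\<in>D. (1 - chi w ones) * ((- Y u) + Y w))
      = (\<Sum>w\<in>D. chi w 0 * ((- Y u) + Y w)) - (\<Sum>w\<in>D. chi w ones * ((- Y u) + Y w))"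
    by (simp only: chi_0 left_diff_distrib sum_subtractf)
  ultimately have "q\<^sup>2 * (- Y u * d 0 0 + (d 0 0 + d (Suc 0) 0)) = q\<^sup>2 * (- Y u * d 0 ones + (d 0 ones + d (Suc 0) ones))"
    unfolding T by simp
  then have eq: "1 - Y u = - Y u * d 0 ones + (d 0 ones + d (Suc 0) ones)"
    using d_code[OF zero_in(1)] q_ge by simp
  have "chi u ones = -1" using assms(2) odd_wt_iff[of u] by (simp add: chi_ones)
  then have "ones \<notin> C" using assms(1) by (auto simp: dual_code_chi chi_commute)
  then have "1 - Y u = d (Suc 0) ones" using eq by (simp add: dist_count_0)
  moreover have "dist_count C 1 ones \<le> 1" by (rule dist_count_le_1) simp
  then have "d (Suc 0) ones = 0 \<or> d (Suc 0) ones = 1" by auto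
  ultimately have "Y u = 1 \<or> Y u = 0" by auto
  then show False using assms(2) even_Y[of u] by auto
qed

text \<open>In the transform at \<open>w\<close> of the quartic with the four values as roots, only
  the zero word contributes, with the value at \<open>q\<close>. The transform is
  \<open>24 * d 4 w\<close>, and \<open>24 * q^2 = 3 * 2 ^ (2 * m + 3)\<close>.\<close>

lemma four_values_prod:
  assumes w: "\<And>k. k < 4 \<Longrightarrow> dist_count C k w = 0" and vals: "Vals = {y1, y2, y3, y4}"
  shows "2 ^ (2 * m + 3) dvd (q - y1) * (q - y2) * (q - y3) * (q - y4)"
proof -
  define f where "f y = (y - y1) * (y - y2) * (y - y3) * (y - y4)" for y
  have f: "f y = y1 * y2 * y3 * y4 + (- (y1 * y2 * y3 + y1 * y2 * y4 + y1 * y3 * y4 + y2 * y3 * y4)) * y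
      + (y1 * y2 + y1 * y3 + y1 * y4 + y2 * y3 + y2 * y4 + y3 * y4) * y\<^sup>2
      + (- (y1 + y2 + y3 + y4)) * y^3 + 1 * y^4" for y
    unfolding f_def by (simp add: algebra_simps power2_eq_square power3_eq_cube numeral_eq_Suc)
  have w0: "d 0 w = 0" "d (Suc 0) w = 0" "d 2 w = 0" "d 3 w = 0" using w by simp_all
  have "(\<Sum>u\<in>D. chi u w * f (Y u)) = q\<^sup>2 * (24 * d 4 w)"
    unfolding f using w0 by (subst quartic_transform[unfolded has_transform_def, rule_format]) simp
  moreover have "(\<Sum>u\<in>D. chi u w * f (Y u)) = f q + (\<Sum>u\<in>D - {0}. chi u w * f (Y u))"
    using zero_in(2) by (simp add: sum.remove[of _ 0] Y_0)
  moreover have "(\<Sum>u\<in>D - {0}. chi u w * f (Y u)) = 0"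
  proof (rule sum.neutral, rule ballI)
    fix u assume "u \<in> D - {0}"
    then have "Y u \<in> {y1, y2, y3, y4}" using vals by blast
    then show "chi u w * f (Y u) = 0" by (auto simp: f_def)
  qed
  ultimately have "f q = 2 ^ (2 * m + 3) * (3 * d 4 w)"
    by (simp add: q power_add power_mult mult.commute[of 2 m])
  then show ?thesis by (simp add: f_def)
qed

lemma four_values_locale:
  assumes w: "\<And>k. k < 4 \<Longrightarrow> dist_count C k w = 0"
    and vals: "Vals = {y1, y2, y3, y4}" and order: "y1 < y2" "y2 < y3" "y3 < y4"
  shows "\<exists>n1 n2 n3 n4. four_values q n1 n2 n3 n4 y1 y2 y3 y4 m"
proof -
  have prod: "2 ^ (2 * m + 3) dvd (q - y1) * (q - y2) * (q - y3) * (q - y4)"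
    by (rule four_values_prod[OF _ vals]) (rule w)
  have bnd: "\<bar>y\<bar> \<le> q - 2" if "y \<in> Vals" for y using that Y_bounds by auto
  have bounds: "\<bar>y1\<bar> \<le> q - 2" "\<bar>y2\<bar> \<le> q - 2" "\<bar>y3\<bar> \<le> q - 2" "\<bar>y4\<bar> \<le> q - 2"
    using bnd unfolding vals by auto
  have ev: "even y1" "even y2" "even y3" "even y4" using even_Y vals by (metis imageE insertCI)+
  have odd_half: "\<exists>k. odd k \<and> q - y = 2 * k" if y: "even y" "\<not> 4 dvd y" for y
  proof -
    obtain z where z: "y = 2 * z" using y(1) by (elim evenE)
    obtain r where r: "q = 4 * r" using four_dvd_q by (elim dvdE)
    have "odd z" using y(2) z by auto
    then show ?thesis using z r by (intro exI[of _ "2 * r - z"]) simp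
  qed
  \<comment> \<open>Two values that are \<open>2\<close> modulo \<open>4\<close> use up only
    \<open>2 ^ 2\<close>, leaving \<open>2 ^ (2 * m + 1)\<close> to two positive factors below
    \<open>2 * q\<close>.\<close>
  have pair: False
    if prems: "2 ^ (2 * m + 3) dvd ((q - a) * (q - b)) * ((q - c) * (q - e))" "\<not> 4 dvd a" "\<not> 4 dvd b"
      "even a" "even b" "\<bar>c\<bar> \<le> q - 2" "\<bar>e\<bar> \<le> q - 2" for a b c e
  proof -
    obtain k l where kl: "odd k" "q - a = 2 * k" "odd l" "q - b = 2 * l" using odd_half[OF prems(4,2)] odd_half[OF prems(5,3)] by blast
    have "2 ^ 2 * 2 ^ (2 * m + 1) dvd 2 ^ 2 * (((q - c) * (q - e)) * (k * l))"
      using prems(1) unfolding kl by (simp add: power_add mult_ac)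
    then have "2 ^ (2 * m + 1) dvd ((q - c) * (q - e)) * (k * l)" by (subst (asm) dvd_times_left_cancel_iff) simp_all
    then have "2 ^ (2 * m + 1) dvd (q - c) * (q - e)" by (rule pow2_dvd_mult_odd) (use kl in simp)
    moreover have "0 < q - c" "q - c < 2 * q" "0 < q - e" "q - e < 2 * q" using prems(6,7) q_ge by linarith+
    ultimately show False using pow2_prod_bound[of "q - c" m "q - e"] q by simp
  qed
  have dvd4: "4 dvd y" if "y \<in> Vals" for y
  proof (rule ccontr)
    assume n: "\<not> 4 dvd y"
    obtain u where "u \<in> D" "Y u = y" using \<open>y \<in> Vals\<close> by auto
    then obtain w where w: "w \<in> D" "\<not> 4 dvd Y w" "Y w \<noteq> y" using two_values_not_dvd4[of u] n by auto
    then have "w \<noteq> 0" using four_dvd_q by (auto simp: Y_0)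
    then have "Y w \<in> {y1, y2, y3, y4}" using w vals by blast
    moreover have "y \<in> {y1, y2, y3, y4}" using \<open>y \<in> Vals\<close> vals by blast
    ultimately have "\<not> 4 dvd y1 \<and> \<not> 4 dvd y2 \<or> \<not> 4 dvd y1 \<and> \<not> 4 dvd y3 \<or> \<not> 4 dvd y1 \<and> \<not> 4 dvd y4
      \<or> \<not> 4 dvd y2 \<and> \<not> 4 dvd y3 \<or> \<not> 4 dvd y2 \<and> \<not> 4 dvd y4 \<or> \<not> 4 dvd y3 \<and> \<not> 4 dvd y4"
      using w n by auto
    then show False
    proof (elim disjE conjE)
      assume n: "\<not> 4 dvd y1" "\<not> 4 dvd y2"
      have "2 ^ (2 * m + 3) dvd ((q - y1) * (q - y2)) * ((q - y3) * (q - y4))"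
        using prod by (simp only: mult_ac)
      then show False using n ev(1,2) bounds(3,4) by (rule pair)
    next
      assume n: "\<not> 4 dvd y1" "\<not> 4 dvd y3"
      have "2 ^ (2 * m + 3) dvd ((q - y1) * (q - y3)) * ((q - y2) * (q - y4))"
        using prod by (simp only: mult_ac)
      then show False using n ev(1,3) bounds(2,4) by (rule pair)
    next
      assume n: "\<not> 4 dvd y1" "\<not> 4 dvd y4"
      have "2 ^ (2 * m + 3) dvd ((q - y1) * (q - y4)) * ((q - y2) * (q - y3))"
        using prod by (simp only: mult_ac)
      then show False using n ev(1,4) bounds(2,3) by (rule pair)
    next
      assume n: "\<not> 4 dvd y2" "\<not> 4 dvd y3"
      have "2 ^ (2 * m + 3) dvd ((q - y2) * (q - y3)) * ((q - y1) * (q - y4))"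
        using prod by (simp only: mult_ac)
      then show False using n ev(2,3) bounds(1,4) by (rule pair)
    next
      assume n: "\<not> 4 dvd y2" "\<not> 4 dvd y4"
      have "2 ^ (2 * m + 3) dvd ((q - y2) * (q - y4)) * ((q - y1) * (q - y3))"
        using prod by (simp only: mult_ac)
      then show False using n ev(2,4) bounds(1,3) by (rule pair)
    next
      assume n: "\<not> 4 dvd y3" "\<not> 4 dvd y4"
      have "2 ^ (2 * m + 3) dvd ((q - y3) * (q - y4)) * ((q - y1) * (q - y2))"
        using prod by (simp only: mult_ac)
      then show False using n ev(3,4) bounds(1,2) by (rule pair)
    qed
  qed
  then have d4: "4 dvd y1" "4 dvd y2" "4 dvd y3" "4 dvd y4" unfolding vals by auto
  have y4_pos: "y4 > 0"
  proof -
    obtain u where "u \<in> D - {0}" "Y u > 0" using sum_Y_pos by blast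
    then have "Y u \<in> {y1, y2, y3, y4}" using vals by blast
    then show ?thesis using \<open>Y u > 0\<close> order by auto
  qed
  \<comment> \<open>A nonzero value \<open>y\<close> and \<open>q - y\<close> contain the same power
    of two. As \<open>q - y4\<close> contains at most \<open>2 ^ (m - 1)\<close>, the other three
    contain together at least \<open>2 ^ (m + 2) = 4 * q\<close>.\<close>
  have prod3: "4 * q dvd y1 * y2 * y3"
  proof (cases "y1 = 0 \<or> y2 = 0 \<or> y3 = 0")
    case False
    have lt: "\<bar>y\<bar> < 2 ^ m" if "\<bar>y\<bar> \<le> q - 2" for y :: int using that q by simp
    obtain a1 k1 l1 where 1: "y1 = 2 ^ a1 * k1" "2 ^ m - y1 = 2 ^ a1 * l1" "odd k1" "odd l1" "a1 < m"
      using pow2_minus_decomp[OF _ lt[OF bounds(1)]] False by blast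
    obtain a2 k2 l2 where 2: "y2 = 2 ^ a2 * k2" "2 ^ m - y2 = 2 ^ a2 * l2" "odd k2" "odd l2" "a2 < m"
      using pow2_minus_decomp[OF _ lt[OF bounds(2)]] False by blast
    obtain a3 k3 l3 where 3: "y3 = 2 ^ a3 * k3" "2 ^ m - y3 = 2 ^ a3 * l3" "odd k3" "odd l3" "a3 < m"
      using pow2_minus_decomp[OF _ lt[OF bounds(3)]] False by blast
    obtain a4 k4 l4 where 4: "y4 = 2 ^ a4 * k4" "2 ^ m - y4 = 2 ^ a4 * l4" "odd k4" "odd l4" "a4 < m"
      using pow2_minus_decomp[OF _ lt[OF bounds(4)]] y4_pos by blast
    have "2 ^ (2 * m + 3) dvd 2 ^ (a1 + a2 + a3 + a4) * (l1 * l2 * l3 * l4)"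
      using prod unfolding q 1(2) 2(2) 3(2) 4(2) by (simp add: power_add mult_ac)
    then have "2 * m + 3 \<le> a1 + a2 + a3 + a4"
      by (rule pow2_dvd_exponent_le) (use 1 2 3 4 in simp)
    then have "m + 2 \<le> a1 + a2 + a3" using 4(5) by simp
    then have "(2::int) ^ (m + 2) dvd 2 ^ (a1 + a2 + a3) * (k1 * k2 * k3)"
      by (intro dvd_mult2 le_imp_power_dvd)
    then show ?thesis unfolding q 1(1) 2(1) 3(1) by (simp add: power_add mult_ac)
  qed auto
  have m4: "m \<ge> 4"
  proof (rule ccontr)
    assume "\<not> m \<ge> 4"
    then have "m = 3" using m_ge by simp
    then have "q = 8" using q by simp
    obtain z1 z2 z3 z4 where z: "y1 = 4 * z1" "y2 = 4 * z2" "y3 = 4 * z3" "y4 = 4 * z4" using d4 by (elim dvdE)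
    show False using order bounds(1,4) unfolding z \<open>q = 8\<close> by presburger
  qed
  define n where "n y = int (card {u \<in> D - {0}. Y u = y})" for y
  have fib: "(\<Sum>u\<in>D - {0}. (g :: int \<Rightarrow> int) (Y u)) = n y1 * g y1 + n y2 * g y2 + n y3 * g y3 + n y4 * g y4" for g
  proof -
    have "(\<Sum>u\<in>D - {0}. g (Y u)) = (\<Sum>y\<in>Vals. \<Sum>u | u \<in> D - {0} \<and> Y u = y. g (Y u))"
      by (rule sum.image_gen) simp
    also have "\<dots> = (\<Sum>y\<in>Vals. n y * g y)" by (rule sum.cong) (simp_all add: n_def)
    finally show ?thesis unfolding vals using order by simp
  qed
  have pos: "n y > 0" if "y \<in> Vals" for y
    using that by (auto simp: n_def card_gt_0_iff)
  have "four_values q (n y1) (n y2) (n y3) (n y4) y1 y2 y3 y4 m"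
  proof
    show "n y1 > 0" "n y2 > 0" "n y3 > 0" "n y4 > 0" using pos unfolding vals by auto
    show "-q < y1" "y4 < q" using bounds by auto
    show "n y1 + n y2 + n y3 + n y4 = (q - 1) * (q + 1)"
      using fib[of "\<lambda>_. 1"] sum_nonzero[of 1 0 0 0 0] by simp
    show "n y1 * y1 + n y2 * y2 + n y3 * y3 + n y4 * y4 = (q - 1) * q"
      using fib[of "\<lambda>y. y"] sum_nonzero[of 0 1 0 0 0] by simp
    show "n y1 * y1\<^sup>2 + n y2 * y2\<^sup>2 + n y3 * y3\<^sup>2 + n y4 * y4\<^sup>2 = (q - 1) * q\<^sup>2"
      using fib[of "\<lambda>y. y\<^sup>2"] sum_nonzero[of 0 0 1 0 0] by simp
    show "n y1 * y1^3 + n y2 * y2^3 + n y3 * y3^3 + n y4 * y4^3 = 2 * (q - 1) * q\<^sup>2"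
      using fib[of "\<lambda>y. y^3"] sum_nonzero[of 0 0 0 1 0] by simp
    show "n y1 * y1^4 + n y2 * y2^4 + n y3 * y3^4 + n y4 * y4^4 = 2 * (q - 1) * q^3"
      using fib[of "\<lambda>y. y^4"] sum_nonzero[of 0 0 0 0 1] by simp
  qed (use q m4 order d4 prod3 in auto)
  then show ?thesis by blast
qed

lemma spanning_four:
  assumes "card Vals = 4" and w: "\<And>k. k < 4 \<Longrightarrow> dist_count C k w = 0"
    and v: "\<And>u. u \<in> D - {0} \<Longrightarrow> Y u = Max Vals \<Longrightarrow> u $ i = 1 \<Longrightarrow> chi u v = 1"
  shows "v \<in> C"
proof (rule ccontr)
  assume "v \<notin> C"
  obtain y1 y2 y3 y4 where order: "y1 < y2" "y2 < y3" "y3 < y4" and vals: "Vals = {y1, y2, y3, y4}"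
    by (rule card_4_sorted[OF assms(1)])
  have "\<exists>n1 n2 n3 n4. four_values q n1 n2 n3 n4 y1 y2 y3 y4 m"
    by (rule four_values_locale[OF _ vals order]) (rule w)
  then obtain n1 n2 n3 n4 where "four_values q n1 n2 n3 n4 y1 y2 y3 y4 m" by (elim exE)
  then interpret four_values q n1 n2 n3 n4 y1 y2 y3 y4 m .
  have max: "Max Vals = y4" unfolding vals using order by (intro Max_eqI) auto
  define s3 where "s3 = y1 * y2 * y3"
  define F where "F x = - s3 * d 0 x + s2 * (d 0 x + d (Suc 0) x) - s1 * (2 * d 2 x + 2 * d (Suc 0) x + q * d 0 x)
    + (6 * (d 3 x + d 2 x) + (3 * q - 2) * (d (Suc 0) x + d 0 x))" for x
  have "has_transform (\<lambda>y. (y - y1) * (y - y2) * (y - y3)) F"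
  proof -
    have "(y - y1) * (y - y2) * (y - y3) = (- s3) + s2 * y + (- s1) * y\<^sup>2 + 1 * y^3 + 0 * y^4" for y
      unfolding s1_def s2_def s3_def by (simp add: algebra_simps power2_eq_square power3_eq_cube)
    then show ?thesis
      using quartic_transform[of "- s3" s2 "- s1" 1 0] by (simp add: F_def[abs_def])
  qed
  moreover have "chi u v = 1" if "u \<in> D - {0}" "(Y u - y1) * (Y u - y2) * (Y u - y3) \<noteq> 0" "u $ i = 1" for u
  proof (rule v[OF that(1) _ that(3)])
    have "Y u \<in> {y1, y2, y3, y4}" using that(1) vals by blast
    then show "Y u = Max Vals" using that(2) max by auto
  qed
  ultimately have "F 0 - F (unit i) - F v + F (v + unit i) = 0" by (rule second_difference)
  moreover have F0: "F x = - s3 + s2 - s1 * q + (3 * q - 2)" if "x \<in> C" for x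
    using d_code[OF that] by (simp add: F_def)
  moreover have F1: "F x = s2 - 2 * s1 + (3 * q - 2)" if "x + unit j \<in> C" for x j
    using d_unit[OF that] by (simp add: F_def)
  moreover have "psi = - s3 + s2 - s1 * q + (3 * q - 2) - (s2 - 2 * s1 + (3 * q - 2))"
    by (simp add: psi_def s3_def algebra_simps)
  ultimately have eq: "psi = F v - F (v + unit i)"
    using zero_in(1) F1[of "unit i" i] by simp
  \<comment> \<open>These bounds exceed the possible drops from \<open>v\<close> to
    \<open>v + unit i\<close>: the third covers \<open>v\<close> at distance \<open>1\<close> from
    \<open>C\<close>, the fourth \<open>v + unit i\<close> at distance \<open>1\<close>, and the
    first two both words at distance at least \<open>2\<close>, according to their counts
    \<open>d 2\<close>.\<close>
  have des: "psi > 2 * (q - 2) + 2 * s1" "psi > 2 * (q - 2) - 2 * s1" "psi > 3 * q - 8 + s2" "psi > - q - 2 - s2"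
    using psi_largeI unfolding psi_large_def by auto
  show False
  proof (cases "v + unit i \<in> C")
    case True
    then have "psi = - psi" using eq F0[OF True] F1[OF True] by (simp add: psi_def s3_def algebra_simps)
    then show False using psi_pos by simp
  next
    case False
    from \<open>v \<notin> C\<close> show False
    proof (cases rule: not_code_cases)
      case (1 j)
      have "F (v + unit i) \<ge> 6 - 2 * s1"
      proof -
        have "d 2 (v + unit i) = 1" using coset_shift[OF 1(1) False] .
        moreover from False have "d 0 (v + unit i) = 0 \<and> d (Suc 0) (v + unit i) = 0"
          by (cases rule: not_code_cases) (use \<open>d 2 (v + unit i) = 1\<close> in auto)
        ultimately show ?thesis by (simp add: F_def)
      qed
      then show False using eq F1[OF 1(1)] des by simp
    next
      case 2
      then have Fv: "F v = - 2 * s1 * d 2 v + 6 * (d 3 v + d 2 v)" by (simp add: F_def)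
      from False show False
      proof (cases rule: not_code_cases)
        case (1 j)
        have "d 2 v = 1"
        proof -
          have "v + unit i + unit i \<notin> C" using \<open>v \<notin> C\<close> by simp
          from coset_shift[OF 1(1) this] show ?thesis by simp
        qed
        then show False using eq F1[OF 1(1)] Fv 2(4) des by simp
      next
        case b: 2
        then have "F (v + unit i) = - 2 * s1 * d 2 (v + unit i) + 6 * (d 3 (v + unit i) + d 2 (v + unit i))"
          by (simp add: F_def)
        then show False using eq Fv 2(3,4) b(3,4) des psi_pos by (elim disjE) simp_all
      qed
    qed
  qed
qed

end

section \<open>Uniformly packed codes\<close>

text \<open>The variable stands for \<open>kraw 1 u\<close> instead of the weight, so the recursion
  is \<open>kraw_rec\<close> solved for its highest term.\<close>

fun kraw_poly :: "real \<Rightarrow> nat \<Rightarrow> real poly" where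
  "kraw_poly N 0 = 1"
| "kraw_poly N (Suc 0) = [:0, 1:]"
| "kraw_poly N (Suc (Suc k)) = smult (1 / real (k + 2))
     ([:0, 1:] * kraw_poly N (Suc k) - smult (N - real k) (kraw_poly N k))"

lemma degree_kraw_poly: "degree (kraw_poly N k) \<le> k"
proof (induction N k rule: kraw_poly.induct)
  case (3 N k)
  have "degree ([:0, 1:] * kraw_poly N (Suc k)) \<le> Suc (Suc k)"
    using degree_mult_le[of "[:0, 1:]" "kraw_poly N (Suc k)"] 3(1) by simp
  moreover have "degree (smult (N - real k) (kraw_poly N k)) \<le> Suc (Suc k)"
    using degree_smult_le[of "N - real k" "kraw_poly N k"] 3(2) by linarith
  ultimately have "degree ([:0, 1:] * kraw_poly N (Suc k) - smult (N - real k) (kraw_poly N k)) \<le> Suc (Suc k)"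
    by (rule degree_diff_le)
  then show ?case using degree_smult_le le_trans by (metis kraw_poly.simps(3))
qed simp_all

lemma poly_kraw_poly:
  fixes u :: "bit ^ 'n::finite"
  shows "poly (kraw_poly (real CARD('n)) k) (of_int (kraw 1 u)) = of_int (kraw k u)"
proof (induction "real CARD('n)" k rule: kraw_poly.induct)
  case (3 k)
  have "kraw 1 u * kraw (Suc k) u = int (k + 2) * kraw (Suc (Suc k)) u + (int CARD('n) - int k) * kraw k u"
    using kraw_rec[of "Suc k" u] by simp
  then have "of_int (kraw 1 u * kraw (Suc k) u) = (of_int (int (k + 2) * kraw (Suc (Suc k)) u + (int CARD('n) - int k) * kraw k u) :: real)"
    by (rule arg_cong)
  then have eq: "of_int (kraw 1 u) * of_int (kraw (Suc k) u) - (real CARD('n) - real k) * of_int (kraw k u)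
      = real (k + 2) * (of_int (kraw (Suc (Suc k)) u) :: real)"
    by simp
  show ?case
    using eq by (simp add: 3 del: One_nat_def of_nat_add)
qed (simp_all add: kraw_0)

text \<open>\<open>dist_count C k\<close> is the convolution of the indicators of \<open>C\<close>
  and of a sphere, and \<open>chi u\<close> is \<open>1\<close> on \<open>C\<close>.\<close>

lemma sum_dist_count_chi:
  assumes u: "u \<in> dual_code (C :: 'n::finite code)"
  shows "(\<Sum>x\<in>UNIV. chi u x * int (dist_count C k x)) = int (card C) * kraw k u"
proof -
  have "(\<Sum>x\<in>UNIV. chi u x * int (dist_count C k x)) = (\<Sum>x\<in>UNIV. \<Sum>e | wt e = k. of_bool (x + e \<in> C) * chi u x)"
    by (rule sum.cong) (simp_all add: dist_count_def Int_def sum_distrib_right[symmetric])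
  also have "\<dots> = (\<Sum>e | wt e = k. int (card C) * chi u e)"
  proof (subst sum.swap, rule sum.cong[OF refl])
    fix e :: "bit ^ 'n"
    have b: "bij_betw (\<lambda>c. c + e) C {x. x + e \<in> C}"
      by (rule bij_betwI[where g = "\<lambda>x. x + e"]) auto
    have "(\<Sum>x\<in>UNIV. of_bool (x + e \<in> C) * chi u x) = (\<Sum>x | x + e \<in> C. chi u x)"
      by (rule sum.mono_neutral_cong_right) auto
    also have "\<dots> = (\<Sum>c\<in>C. chi u (c + e))" by (rule sum.reindex_bij_betw[OF b, symmetric])
    also have "\<dots> = (\<Sum>c\<in>C. chi u e)"
      using u by (intro sum.cong) (auto simp: chi_add_right dual_code_chi chi_commute[of u])
    finally show "(\<Sum>x\<in>UNIV. of_bool (x + e \<in> C) * chi u x) = int (card C) * chi u e" by simp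
  qed
  finally show ?thesis by (simp add: kraw_def sum_distrib_left)
qed

lemma sum_chi_UNIV: "(\<Sum>x\<in>UNIV. chi u x) = (if u = 0 then 2 ^ CARD('n) else 0)" for u :: "bit ^ 'n::finite"
proof -
  have "(\<Sum>x\<in>UNIV. chi u x) = (\<Sum>x\<in>UNIV. chi x u)" by (simp add: chi_commute)
  also have "\<dots> = (if u = 0 then 2 ^ CARD('n) else 0)"
    by (subst sum_chi_subspace) (auto simp: subspace_iff chi_eq_1_iff CARD_bit)
  finally show ?thesis .
qed

text \<open>The Fourier transform of the defining equation of a uniformly packed code is supported at \<open>0\<close>;
  on the dual code it is a polynomial of degree at most the covering radius in the weight.\<close>
lemma uniformly_packed_few_weights:
  fixes C :: "'n::finite code"
  assumes sub: "vec.subspace C" and up: "uniformly_packed C"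
  shows "card (kraw 1 ` (dual_code C - {0})) \<le> covering_radius C"
proof -
  let ?r = "covering_radius C"
  obtain a where a: "\<And>x. (\<Sum>k\<le>?r. a k * real (dist_count C k x)) = 1"
    using up unfolding uniformly_packed_def codewords_at_eq atLeast0AtMost by blast
  define p where "p = (\<Sum>k\<le>?r. smult (a k) (kraw_poly (real CARD('n)) k))"
  have C0: "card C > 0" using sub by (auto simp: subspace_iff card_gt_0_iff)
  \<comment> \<open>The packing equation is multiplied by \<open>chi u x\<close> and summed over
    \<open>x\<close>. The value at \<open>u = 0\<close> shows that \<open>p\<close> is not zero, and
    the nonzero dual words give roots of \<open>p\<close>.\<close>
  have key: "real (card C) * poly p (of_int (kraw 1 u)) = (if u = 0 then 2 ^ CARD('n) else 0)" if "u \<in> dual_code C" for u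
  proof -
    have "(if u = 0 then 2 ^ CARD('n) else 0) = (of_int (\<Sum>x\<in>UNIV. chi u x) :: real)"
      unfolding sum_chi_UNIV by simp
    also have "\<dots> = (\<Sum>x\<in>UNIV. of_int (chi u x) * (\<Sum>k\<le>?r. a k * real (dist_count C k x)))"
      unfolding a by simp
    also have "\<dots> = (\<Sum>k\<le>?r. a k * of_int (\<Sum>x\<in>UNIV. chi u x * int (dist_count C k x)))"
      unfolding sum_distrib_left of_int_sum by (subst sum.swap) (simp add: mult_ac)
    also have "\<dots> = real (card C) * (\<Sum>k\<le>?r. a k * of_int (kraw k u))"
      unfolding sum_dist_count_chi[OF that] by (simp add: sum_distrib_left mult_ac)
    also have "(\<Sum>k\<le>?r. a k * of_int (kraw k u)) = poly p (of_int (kraw 1 u))"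
      unfolding p_def poly_sum poly_smult poly_kraw_poly ..
    finally show ?thesis by simp
  qed
  have "poly p (of_int (kraw 1 (0 :: bit ^ 'n))) \<noteq> 0"
    using key[of 0] subspace_dual[of C] by (auto simp: subspace_iff)
  then have p0: "p \<noteq> 0" by auto
  have "degree p \<le> ?r"
    unfolding p_def
  proof (rule degree_sum_le)
    fix k assume "k \<in> {..?r}"
    then show "degree (smult (a k) (kraw_poly (real CARD('n)) k)) \<le> ?r"
      using degree_smult_le[of "a k" "kraw_poly (real CARD('n)) k"] degree_kraw_poly[of "real CARD('n)" k]
      by (simp only: atMost_iff)
  qed simp
  have "card (kraw 1 ` (dual_code C - {0})) = card (of_int ` kraw 1 ` (dual_code C - {0}) :: real set)"
    by (rule card_image[symmetric]) (simp add: inj_on_def)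
  also have "\<dots> \<le> card {x. poly p x = 0}"
  proof (intro card_mono poly_roots_finite p0 subsetI)
    fix x :: real assume "x \<in> of_int ` kraw 1 ` (dual_code C - {0})"
    then obtain u where "u \<in> dual_code C" "u \<noteq> 0" "x = of_int (kraw 1 u)" by blast
    then show "x \<in> {x. poly p x = 0}" using key[of u] C0 by auto
  qed
  also have "\<dots> \<le> degree p" by (rule card_poly_roots_bound[OF p0])
  finally show ?thesis using \<open>degree p \<le> ?r\<close> by simp
qed

section \<open>The covering radius, and connectedness of the graph\<close>

lemma covering_radius_witness:
  fixes C :: "'n::finite code"
  assumes "C \<noteq> {}"
  obtains w where "\<And>k. k < covering_radius C \<Longrightarrow> dist_count C k w = 0"
proof -
  have "covering_radius C \<in> range (\<lambda>x. Min (hamming_dist x ` C))"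
    unfolding covering_radius_def by (rule Max_in) auto
  then obtain w where w: "covering_radius C = Min (hamming_dist w ` C)" by auto
  have "dist_count C k w = 0" if "k < covering_radius C" for k
  proof -
    have "wt e \<noteq> k" if e: "w + e \<in> C" for e
    proof -
      have "hamming_dist w (w + e) = wt e" by (simp add: hamming_dist_wt)
      then have "Min (hamming_dist w ` C) \<le> wt e" using e by (metis Min_le finite finite_imageI imageI)
      then show ?thesis using \<open>k < _\<close> w by simp
    qed
    then have "{e. wt e = k \<and> w + e \<in> C} = {}" by auto
    then show ?thesis by (simp add: dist_count_def)
  qed
  then show ?thesis using that by blast
qed

context code5_dual
begin

text \<open>A coset at distance at least \<open>5\<close> could be added to the code, contradicting the Johnson-type bound.\<close>
lemma covering_radius_le: "covering_radius C \<le> 4"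
proof (rule ccontr)
  assume "\<not> covering_radius C \<le> 4"
  obtain w where "\<And>k. k < covering_radius C \<Longrightarrow> dist_count C k w = 0"
    by (rule covering_radius_witness[of C]) (use zero_in in auto)
  then have w: "dist_count C k w = 0" if "k < 5" for k using \<open>\<not> covering_radius C \<le> 4\<close> that by simp
  have far: "wt e \<ge> 5" if "w + e \<in> C" for e
  proof (rule ccontr)
    assume "\<not> wt e \<ge> 5"
    then have "dist_count C (wt e) w = 0" using w by simp
    then show False using dist_count_pos_iff[of "wt e" w] that by auto
  qed
  define E where "E = C \<union> (+) w ` C"
  have add: "x + y \<in> C" if "x \<in> C" "y \<in> C" for x y using that subspace by (auto simp: subspace_iff)
  have mem: "x \<in> E \<longleftrightarrow> x \<in> C \<or> w + x \<in> C" for x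
    by (auto simp: E_def image_iff) (metis word_add_cancel)
  have "x + y \<in> E" if "x \<in> E" "y \<in> E" for x y
  proof -
    have 1: "w + (x + y) = (w + x) + y" "w + (x + y) = x + (w + y)" by (simp_all only: add.assoc add.left_commute)
    have "x + y = w + (w + (x + y))" by (simp only: word_add_cancel)
    also have "\<dots> = (w + x) + (w + y)" by (simp only: add.assoc add.left_commute)
    finally have 2: "x + y = (w + x) + (w + y)" .
    show ?thesis using that add 1 2 unfolding mem by metis
  qed
  then have "vec.subspace E" using zero_in by (auto simp: subspace_iff E_def)
  moreover have "wt c \<ge> 5" if "c \<in> E" "c \<noteq> 0" for c
    using that wt_ge far unfolding mem by blast
  ultimately interpret E: code5 E m q
    using q odd_m m_ge length by unfold_locales auto
  have disj: "C \<inter> (+) w ` C = {}"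
  proof -
    have False if "c \<in> C" "w + c \<in> C" for c
      using far[of 0] add[OF that] that by (auto simp: add.commute[of w])
    then show ?thesis by auto
  qed
  have "card E = 2 * card C"
    unfolding E_def using disj by (subst card_Un_disjoint) (auto simp: card_image)
  \<comment> \<open>For the doubled code the bound becomes
    \<open>card C * (q * (q + 1)) \<le> card C * q^2\<close>.\<close>
  then have "2 * (int (card C) * (q * (q + 1))) \<le> 2 * 2 ^ CARD('n)" using E.johnson by simp
  also have "(2::int) ^ CARD('n) = int (card C) * q\<^sup>2"
  proof -
    have "int (card C * card D) = 2 ^ CARD('n)" using card_dual[OF subspace] by simp
    then show ?thesis using card_dual_eq by simp
  qed
  finally have "int (card C) * (q * (q + 1)) \<le> int (card C) * q\<^sup>2" by simp
  moreover have "card C > 0" using zero_in by (auto simp: card_gt_0_iff)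
  ultimately show False using q_ge by (simp add: power2_eq_square)
qed

lemma i_graph_dual_connected:
  assumes "uniformly_packed C"
  shows "i_component i D D \<and> Digraph_Component.connected (with_proj (i_graph i D))"
proof (rule i_graph_connected[OF subspace_dual])
  fix v assume *: "\<And>u. u \<in> D \<Longrightarrow> wt u = min_dist D \<Longrightarrow> u $ i = 1 \<Longrightarrow> chi u v = 1"
  \<comment> \<open>\<open>Y\<close> decreases with the weight, so its largest value on
    \<open>D - {0}\<close> marks the words of minimum weight.\<close>
  have v: "chi u v = 1" if u: "u \<in> D - {0}" "Y u = Max Vals" "u $ i = 1" for u
  proof -
    have "Min (wt ` (D - {0})) = wt u"
    proof (rule Min_eqI)
      fix k assume "k \<in> wt ` (D - {0})"
      then obtain w where "w \<in> D - {0}" "k = wt w" by blast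
      moreover from this have "Y w \<le> Y u" unfolding u(2) by (intro Max_ge) auto
      ultimately show "wt u \<le> k" by (simp add: Y_def)
    qed (use u in auto)
    then show ?thesis using * u min_dist_subspace[OF subspace_dual, of C] by simp
  qed
  have "Vals = (\<lambda>x. x + 1) ` kraw 1 ` (D - {0})" by (auto simp: image_image kraw_rels(1) simp del: One_nat_def)
  then have "card Vals = card (kraw 1 ` (D - {0}))" by (simp add: card_image)
  then have le: "card Vals \<le> covering_radius C"
    using uniformly_packed_few_weights[OF subspace assms] by simp
  have "v \<in> C"
  proof (cases "card Vals \<le> 3")
    case True
    then show ?thesis using spanning_few v by blast
  next
    case False
    \<comment> \<open>Four values force covering radius exactly \<open>4\<close>, which supplies the
      word at distance \<open>4\<close> needed for the divisibility argument.\<close>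
    then have r: "card Vals = 4" "covering_radius C = 4" using le covering_radius_le by auto
    obtain w where "\<And>k. k < covering_radius C \<Longrightarrow> dist_count C k w = 0"
      by (rule covering_radius_witness[of C]) (use zero_in in auto)
    then show ?thesis using spanning_four[OF r(1), of w i v] v unfolding r(2) by blast
  qed
  then show "v \<in> dual_code D" by (simp add: dual_dual[OF subspace])
qed

end

section \<open>Cardinality of subspaces over the field with two elements\<close>

lemma card_span_bit:
  assumes "finite B" "vec.independent (B :: (bit ^ 'n::finite) set)"
  shows "card (vec.span B) = 2 ^ card B"
  using assms
proof induction
  case (insert b B)
  then have ind: "vec.independent B" "b \<notin> vec.span B" by (simp_all add: vec.independent_insert)
  have sub: "vec.subspace (vec.span B)" by (rule vec.subspace_span)
  have "vec.span (insert b B) = vec.span B \<union> (+) b ` vec.span B"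
  proof -
    have "(\<exists>k. x - k *s b \<in> vec.span B) \<longleftrightarrow> x \<in> vec.span B \<or> b + x \<in> vec.span B" for x
    proof -
      have "(\<exists>k :: bit. P k) \<longleftrightarrow> P 0 \<or> P 1" for P by (metis bit.exhaust)
      then show ?thesis by (simp add: word_minus_eq add.commute[of b])
    qed
    moreover have "x \<in> (+) b ` vec.span B \<longleftrightarrow> b + x \<in> vec.span B" for x
      by (auto simp: image_iff) (metis word_add_cancel)
    ultimately show ?thesis unfolding vec.span_insert by auto
  qed
  moreover have "vec.span B \<inter> (+) b ` vec.span B = {}"
  proof -
    have False if "c \<in> vec.span B" "b + c \<in> vec.span B" for c
    proof -
      have "(b + c) + c \<in> vec.span B" using that sub unfolding subspace_iff by blast
      then show False using ind(2) by (simp only: word_add_cancel_right)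
    qed
    then show ?thesis by auto
  qed
  ultimately have "card (vec.span (insert b B)) = 2 * card (vec.span B)"
    by (simp add: card_Un_disjoint card_image)
  then show ?case using insert ind by simp
qed simp

lemma card_subspace_bit:
  assumes "vec.subspace (C :: 'n::finite code)"
  shows "card C = 2 ^ vec.dim C"
proof -
  obtain B where B: "B \<subseteq> C" "vec.independent B" "C \<subseteq> vec.span B" "card B = vec.dim C"
    using vec.basis_exists[of C] by blast
  have "vec.span B = C" using B assms by (simp add: vec.span_minimal subset_antisym)
  then show ?thesis using card_span_bit[of B] B by simp
qed

section \<open>The BCH code\<close>

text \<open>Translation by \<open>1\<close> permutes the field and so preserves the sum of all
  elements, whence the number of elements is \<open>0\<close> in the field.\<close>

lemma two_eq_0_of_CARD:
  assumes "CARD('f::{field,finite}) = 2 ^ m"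
  shows "(2 :: 'f) = 0"
proof -
  have "bij (\<lambda>x :: 'f. x + 1)" by (rule bij_betwI[where g = "\<lambda>x. x - 1"]) auto
  then have "(\<Sum>x\<in>UNIV. x + 1 :: 'f) = (\<Sum>x\<in>UNIV. x)" by (rule sum.reindex_bij_betw)
  then have "(of_nat CARD('f) :: 'f) = 0" by (simp add: sum.distrib)
  then show ?thesis by (simp add: assms)
qed

text \<open>Any four elements with zero sum satisfy
  \<open>a\<^sup>3 + b\<^sup>3 + c\<^sup>3 + d\<^sup>3 = -3 (a + b) (b + c) (c + a)\<close>.\<close>
lemma power_sums_nonzero:
  fixes B :: "'f::field set"
  assumes two: "(2 :: 'f) = 0" and B: "B \<noteq> {}" "card B \<le> 4" "finite B" "0 \<notin> B" and s1: "\<Sum>B = 0"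
  shows "(\<Sum>b\<in>B. b ^ 3) \<noteq> 0"
proof
  assume s3: "(\<Sum>b\<in>B. b ^ 3) = 0"
  have three: "(3 :: 'f) \<noteq> 0"
  proof -
    have "(3 :: 'f) = 2 + 1" by simp
    then show ?thesis using two by simp
  qed
  have neg: "- x = x" for x :: 'f
  proof -
    have "x + x = 2 * x" by simp
    then have "x + x = 0" using two by simp
    then show ?thesis by (simp add: minus_unique)
  qed
  have "card B \<noteq> 0" using B by simp
  then consider "card B = 1" | "card B = 2" | "card B = 3" | "card B = 4" using B(2) by linarith
  then show False
  proof cases
    case 1
    then obtain a where "B = {a}" by (rule card_1_singletonE)
    then show False using s1 B by simp
  next
    case 2
    then obtain a b where "B = {a, b}" "a \<noteq> b" by (auto simp: card_2_iff)
    then have "a + b = 0" using s1 by simp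
    then show False using neg[of b] \<open>a \<noteq> b\<close> by (simp add: add_eq_0_iff)
  next
    case 3
    then obtain a b c where abc: "B = {a, b, c}" "a \<noteq> b" "b \<noteq> c" "a \<noteq> c" by (auto simp: card_3_iff)
    then have "a + b + c = 0" "a ^ 3 + b ^ 3 + c ^ 3 = 0" using s1 s3 by (simp_all add: add.assoc)
    \<comment> \<open>With zero sum the cubes add up to \<open>3 * (a * b * c)\<close>, which is
      nonzero as \<open>0 \<notin> B\<close>.\<close>
    moreover have "a ^ 3 + b ^ 3 + c ^ 3 - 3 * (a * b * c) = (a + b + c) * (a ^ 2 + b ^ 2 + c ^ 2 - a * b - b * c - a * c)"
      by (simp add: algebra_simps power2_eq_square power3_eq_cube)
    ultimately have "3 * (a * b * c) = 0" by simp
    then show False using three B(4) abc by auto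
  next
    case 4
    then obtain a where "a \<in> B" by fastforce
    then have "card (B - {a}) = 3" using 4 by simp
    then obtain b c e where bce: "B - {a} = {b, c, e}" "b \<noteq> c" "c \<noteq> e" "b \<noteq> e" by (auto simp: card_3_iff)
    have Beq: "B = {a, b, c, e}" "a \<noteq> b" "a \<noteq> c" "a \<noteq> e" using bce(1) \<open>a \<in> B\<close> by auto
    have sum0: "a + b + c + e = 0" and cub: "a ^ 3 + b ^ 3 + c ^ 3 + e ^ 3 = 0"
      using s1 s3 bce Beq by (simp_all add: add.assoc)
    have e: "e = - (a + b + c)" using sum0 by (simp add: add_eq_0_iff)
    have "- 3 * ((a + b) * (b + c) * (c + a)) = a ^ 3 + b ^ 3 + c ^ 3 + e ^ 3"
      unfolding e by (simp add: algebra_simps power3_eq_cube)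
    then have "(a + b) * (b + c) * (c + a) = 0" using cub three by simp
    then have "a = b \<or> b = c \<or> c = a" using neg by (metis add_eq_0_iff mult_eq_0_iff)
    then show False using Beq bce by auto
  qed
qed

text \<open>A repetition among these powers would give a period \<open>j - i\<close> too short to
  reach every nonzero element.\<close>

lemma primitive_element_inj:
  fixes \<alpha> :: "'f::{field,finite}"
  assumes "primitive_element \<alpha>"
  shows "\<alpha> \<noteq> 0" and "inj_on (\<lambda>k. \<alpha> ^ k) {..<CARD('f) - 1}"
proof -
  have range: "range (\<lambda>k::nat. \<alpha> ^ k) = UNIV - {0}" using assms by (simp add: primitive_element_def)
  then have "\<alpha> ^ 1 \<in> UNIV - {0}" by blast
  then show \<alpha>: "\<alpha> \<noteq> 0" by simp
  have "\<alpha> ^ i \<noteq> \<alpha> ^ j" if "i < j" "j < CARD('f) - 1" for i j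
  proof
    assume "\<alpha> ^ i = \<alpha> ^ j"
    also have "\<dots> = \<alpha> ^ i * \<alpha> ^ (j - i)" using that by (simp flip: power_add)
    finally have one: "\<alpha> ^ (j - i) = 1" using \<alpha> by simp
    have "UNIV - {0} \<subseteq> (\<lambda>k. \<alpha> ^ k) ` {..<j - i}"
    proof
      fix x :: 'f assume "x \<in> UNIV - {0}"
      then obtain k where "x = \<alpha> ^ k" using range by blast
      also have "\<alpha> ^ k = \<alpha> ^ (k mod (j - i))"
      proof -
        have "\<alpha> ^ k = \<alpha> ^ ((j - i) * (k div (j - i)) + k mod (j - i))" by simp
        also have "\<dots> = \<alpha> ^ (k mod (j - i))" by (simp only: power_add power_mult one) simp
        finally show ?thesis .
      qed
      finally show "x \<in> (\<lambda>k. \<alpha> ^ k) ` {..<j - i}" using that by auto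
    qed
    then have "card (UNIV - {0 :: 'f}) \<le> card {..<j - i}" using surj_card_le by blast
    then show False using that by simp
  qed
  then show "inj_on (\<lambda>k. \<alpha> ^ k) {..<CARD('f) - 1}" by (intro linorder_inj_onI) auto
qed

text \<open>Translation by one of its words maps a nonempty fibre into the kernel, so no fibre is
  larger than the kernel.\<close>

lemma card_le_card_kernel:
  fixes h :: "bit ^ 'n::finite \<Rightarrow> 'b::{ab_group_add,finite}"
  assumes add: "\<And>x y. h (x + y) = h x + h y"
  shows "2 ^ CARD('n) \<le> CARD('b) * card {x. h x = 0}"
proof -
  have "card {x. h x = b} \<le> card {x. h x = 0}" for b
  proof (cases "\<exists>y. h y = b")
    case True
    then obtain y where y: "h y = b" by blast
    have "h 0 = 0" using add[of 0 0] by simp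
    then have "b + b = 0" using add[of y y] y by simp
    then have "(+) y ` {x. h x = b} \<subseteq> {x. h x = 0}" using y by (auto simp: add)
    then have "card ((+) y ` {x. h x = b}) \<le> card {x. h x = 0}" by (intro card_mono) auto
    then show ?thesis by (simp add: card_image)
  qed auto
  then have "(\<Sum>b\<in>UNIV. card {x. h x = b}) \<le> (\<Sum>b\<in>(UNIV :: 'b set). card {x. h x = 0})"
    by (intro sum_mono)
  moreover have "(\<Sum>b\<in>UNIV. card {x. h x = b}) = CARD(bit ^ 'n)"
    using sum.group[of UNIV "UNIV :: 'b set" h "\<lambda>_. 1 :: nat"] by simp
  ultimately show ?thesis by (simp add: CARD_bit)
qed

lemma poly_codeword_poly: "poly (codeword_poly pos c) x = (\<Sum>i\<in>supp c. x ^ pos i)"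
  unfolding codeword_poly_def supp_def by (simp add: poly_sum poly_monom)

theorem corollary1:
  fixes m :: nat
    and \<alpha> :: "'f::{field,finite}"
    and pos :: "'n::finite \<Rightarrow> nat"
    and C :: "'n code"
  assumes "m \<ge> 3" and "odd m"
    and "CARD('f) = 2 ^ m" and "primitive_element \<alpha>"
    and "CARD('n) = 2 ^ m - 1" and "bij_betw pos UNIV {..<2 ^ m - 1}"
    and "vec.subspace C" and "uniformly_packed C"
    and "vec.dim C = vec.dim (bch_1_3 pos \<alpha>)"
    and "min_dist C = min_dist (bch_1_3 pos \<alpha>)"
  shows "\<forall>i. i_component i (dual_code C) (dual_code C)
           \<and> Digraph_Component.connected (with_proj (i_graph i (dual_code C)))"
proof -
  define q :: int where "q = 2 ^ m"
  let ?B = "bch_1_3 pos \<alpha> :: 'n code"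
  have two: "(2 :: 'f) = 0" using assms(3) by (rule two_eq_0_of_CARD)
  \<comment> \<open>The pair of syndromes at \<open>\<alpha>\<close> and
    \<open>\<alpha> ^ 3\<close>; it is additive because common support positions cancel in
    characteristic \<open>2\<close>.\<close>
  define h where "h c = ((\<Sum>i\<in>supp c. \<alpha> ^ pos i), (\<Sum>i\<in>supp c. (\<alpha> ^ 3) ^ pos i))" for c :: "bit ^ 'n"
  have B: "?B = {c. h c = 0}" by (simp add: bch_1_3_def poly_codeword_poly h_def zero_prod_def)
  have sum_add: "(\<Sum>i\<in>supp (x + y). f i) = (\<Sum>i\<in>supp x. f i) + (\<Sum>i\<in>supp y. f i)" for x y :: "bit ^ 'n" and f :: "'n \<Rightarrow> 'f"
  proof -
    have z: "s + s = 0" for s :: 'f using two mult_2[of s] by simp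
    have "(\<Sum>i\<in>supp x. f i) = (\<Sum>i\<in>supp x \<inter> supp y. f i) + (\<Sum>i\<in>supp x - supp y. f i)"
      "(\<Sum>i\<in>supp y. f i) = (\<Sum>i\<in>supp x \<inter> supp y. f i) + (\<Sum>i\<in>supp y - supp x. f i)"
      using sum.Int_Diff[of "supp x" f "supp y"] sum.Int_Diff[of "supp y" f "supp x"] by (simp_all add: Int_commute)
    then have "(\<Sum>i\<in>supp x. f i) + (\<Sum>i\<in>supp y. f i) = (\<Sum>i\<in>supp x - supp y. f i) + (\<Sum>i\<in>supp y - supp x. f i)
        + ((\<Sum>i\<in>supp x \<inter> supp y. f i) + (\<Sum>i\<in>supp x \<inter> supp y. f i))" by (simp only: ac_simps)
    also have "\<dots> = (\<Sum>i\<in>supp (x + y). f i)"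
      unfolding z supp_add by (subst sum.union_disjoint) auto
    finally show ?thesis by simp
  qed
  have h_add: "h (x + y) = h x + h y" for x y by (simp add: h_def sum_add)
  then have h0: "h 0 = 0" using h_add[of 0 0] by simp
  have subB: "vec.subspace ?B" unfolding B subspace_iff by (simp add: h_add h0)
  have inj: "inj (\<lambda>i. \<alpha> ^ pos i)"
  proof -
    have "inj_on ((\<lambda>k. \<alpha> ^ k) \<circ> pos) UNIV"
      using assms(6) primitive_element_inj(2)[OF assms(4)] unfolding assms(3) bij_betw_def
      by (intro comp_inj_on) auto
    then show ?thesis by (simp add: comp_def)
  qed
  have wtB: "wt c \<ge> 5" if "c \<in> ?B" "c \<noteq> 0" for c
  proof (rule ccontr)
    assume "\<not> wt c \<ge> 5"
    \<comment> \<open>A nonzero codeword of weight at most \<open>4\<close> would yield at most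
      \<open>4\<close> nonzero field elements whose first and third power sums both vanish.\<close>
    define S where "S = (\<lambda>i. \<alpha> ^ pos i) ` supp c"
    have inj': "inj_on (\<lambda>i. \<alpha> ^ pos i) (supp c)" using inj by (rule inj_on_subset) simp
    have "card S = wt c" unfolding S_def wt_def using inj' by (rule card_image)
    moreover have "\<Sum>S = 0" "(\<Sum>b\<in>S. b ^ 3) = 0"
      using that(1) unfolding B S_def h_def
      by (simp_all add: sum.reindex[OF inj'] zero_prod_def power_mult[symmetric] mult.commute[of 3])
    moreover have "0 \<notin> S"
    proof
      assume "0 \<in> S"
      then obtain i where "\<alpha> ^ pos i = 0" by (auto simp: S_def)
      then show False using primitive_element_inj(1)[OF assms(4)] by simp
    qed
    moreover have "S \<noteq> {}" unfolding S_def using that(2) supp_inject[of c 0] by simp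
    ultimately show False
      using power_sums_nonzero[OF two, of S] \<open>\<not> wt c \<ge> 5\<close> by (simp add: S_def)
  qed
  have length: "int CARD('n) = q - 1" using assms(5) by (simp add: q_def of_nat_diff)
  interpret B: code5 ?B m q
    using subB q_def assms(1,2) length wtB by unfold_locales auto
  \<comment> \<open>Counting syndromes bounds the dimension below by the length minus
    \<open>2 * m\<close>; \<open>card_le\<close> gives the matching upper bound.\<close>
  have "CARD('f \<times> 'f) = 2 ^ (2 * m)" using assms(3) by (simp add: power_mult power2_eq_square mult_2 power_add)
  then have "2 ^ CARD('n) \<le> 2 ^ (2 * m) * card ?B"
    using card_le_card_kernel[of h, OF h_add] B by simp
  also have "\<dots> = 2 ^ (2 * m + vec.dim ?B)" by (simp add: card_subspace_bit[OF subB] power_add)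
  finally have "CARD('n) \<le> 2 * m + vec.dim ?B" by simp
  then have dim: "vec.dim ?B + 2 * m = CARD('n)"
    using B.card_le[OF card_subspace_bit[OF subB]] by simp
  \<comment> \<open>Positive dimension provides nonzero codewords in both codes, so that the minima
    defining \<open>min_dist\<close> are taken over nonempty sets.\<close>
  have "2 * m + 1 < 2 ^ m"
    using assms(1) by (induction m rule: dec_induct) auto
  then have "vec.dim ?B > 0" using dim assms(5) by simp
  have nontriv: "S - {0} \<noteq> {}" if "vec.subspace S" "vec.dim S = vec.dim ?B" for S :: "'n code"
  proof
    assume "S - {0} = {}"
    then have "S \<subseteq> {0}" by blast
    then have "card S \<le> card {0 :: bit ^ 'n}" by (intro card_mono) auto
    then have "2 ^ vec.dim S \<le> (1 :: nat)" using card_subspace_bit[OF that(1)] by simp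
    moreover have "(1 :: nat) < 2 ^ vec.dim ?B" using \<open>vec.dim ?B > 0\<close> by (intro one_less_power) auto
    ultimately show False using that(2) by simp
  qed
  have "min_dist C \<ge> 5"
    unfolding assms(10) min_dist_subspace[OF subB]
    using nontriv[OF subB refl] wtB by (subst Min_ge_iff) auto
  then have Min_ge: "Min (wt ` (C - {0})) \<ge> 5" unfolding min_dist_subspace[OF assms(7)] .
  have wtC: "wt c \<ge> 5" if "c \<in> C" "c \<noteq> 0" for c
  proof -
    have "Min (wt ` (C - {0})) \<le> wt c" using that by (intro Min_le) auto
    then show ?thesis using Min_ge by simp
  qed
  have "card C * card (dual_code C) = 2 ^ CARD('n)" by (rule card_dual[OF assms(7)])
  then have "2 ^ vec.dim ?B * card (dual_code C) = 2 ^ vec.dim ?B * 2 ^ (2 * m)"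
    unfolding card_subspace_bit[OF assms(7)] assms(9) dim[symmetric] by (simp add: power_add)
  then have "card (dual_code C) = 2 ^ (2 * m)" by simp
  then have "int (card (dual_code C)) = q\<^sup>2" by (simp add: q_def power_mult mult.commute[of 2 m])
  then interpret code5_dual C m q
    using assms(7,2,1) q_def length wtC by unfold_locales auto
  show ?thesis by (intro allI i_graph_dual_connected[OF assms(8)])
qed

end
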